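(* For every graph class $\mathcal{G}$, the underlying treewidth of $\mathcal{G}$ equals the minimum $c\in\mathbb{N}_0$ such that for some function $g:\mathbb{N}_0\to\mathbb{N}$, every graph $G\in\mathcal{G}$ has a $(c,g(\mathrm{tw}(G)))$-disjointed $g(\mathrm{tw}(G))$-partition (in particular, one side is unbounded iff the other is).
   Context: Graphs are finite, simple and undirected; $\mathrm{tw}$ denotes treewidth; a graph class is a set of graphs closed under isomorphism. For graphs $G,H$, an $H$-partition of $G$ is a partition $(V_x : x\in V(H))$ of $V(G)$ such that for every edge $vw$ of $G$ with $v\in V_x$, $w\in V_y$, either $x=y$ or $xy\in E(H)$; its width is $\max_x|V_x|$. $\mathrm{tpw}_c(G)$ is the minimum width of an $H$-partition of $G$ over all graphs $H$ with $\mathrm{tw}(H)\le c$. The underlying treewidth of $\mathcal{G}$ is the minimum $c\in\mathbb{N}_0$ for which there is a function $f$ with $\mathrm{tpw}_c(G)\le f(\mathrm{tw}(G))$ for all $G\in\mathcal{G}$ (unbounded if no such $c$ exists). For $B\subseteq V(G)$, $N_G(B)$ is the set of vertices adjacent to some vertex of $B$. An $\ell$-partition of $G$ is a set $\beta$ of pairwise disjoint subsets of $V(G)$, each of size at most $\ell$, whose union is $V(G)$. It is $(c,d)$-disjointed if for every $(B_1,\dots,B_c)\in\beta^c$ and every connected component $X$ of $G-(B_1\cup\dots\cup B_c)$ there is $Q\subseteq V(X)$ with $|Q|\le d$ such that every connected component $Y$ of $X-Q$ satisfies $V(Y)\cap N_G(B_i')=\emptyset$ for some $i\in\{1,\dots,c\}$,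 where $B_i':=B_i\setminus(B_1\cup\dots\cup B_{i-1})$. *)

theory Defs
  imports Main "HOL-Library.Extended_Nat"
begin

type_synonym ugraph = "nat set \<times> nat set set"

definition verts :: "ugraph \<Rightarrow> nat set" where "verts G = fst G"
definition edges :: "ugraph \<Rightarrow> nat set set" where "edges G = snd G"

definition is_graph :: "ugraph \<Rightarrow> bool" where
  "is_graph G \<longleftrightarrow> finite (verts G) \<and>
     (\<forall>e\<in>edges G. \<exists>u v. e = {u, v} \<and> u \<noteq> v \<and> u \<in> verts G \<and> v \<in> verts G)"

definition adj :: "ugraph \<Rightarrow> nat \<Rightarrow> nat \<Rightarrow> bool" where
  "adj G u v \<longleftrightarrow> {u, v} \<in> edges G \<and> u \<noteq> v"

definition isomorphic :: "ugraph \<Rightarrow> ugraph \<Rightarrow> bool" where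
  "isomorphic G G' \<longleftrightarrow> (\<exists>f. bij_betw f (verts G) (verts G') \<and>
     (\<forall>u\<in>verts G. \<forall>v\<in>verts G. adj G u v \<longleftrightarrow> adj G' (f u) (f v)))"

definition graph_class :: "ugraph set \<Rightarrow> bool" where
  "graph_class \<G> \<longleftrightarrow> (\<forall>G\<in>\<G>. is_graph G) \<and>
     (\<forall>G\<in>\<G>. \<forall>G'. is_graph G' \<and> isomorphic G G' \<longrightarrow> G' \<in> \<G>)"

definition connected_in :: "ugraph \<Rightarrow> nat set \<Rightarrow> bool" where
  "connected_in G W \<longleftrightarrow> (\<forall>u\<in>W. \<forall>v\<in>W.
     (\<lambda>x y. x \<in> W \<and> y \<in> W \<and> adj G x y)\<^sup>*\<^sup>* u v)"

definition components :: "ugraph \<Rightarrow> nat set \<Rightarrow> nat set set" where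
  "components G W = {C. C \<subseteq> W \<and> C \<noteq> {} \<and> connected_in G C \<and>
     (\<forall>C'. C \<subseteq> C' \<and> C' \<subseteq> W \<and> connected_in G C' \<longrightarrow> C' = C)}"

definition is_cycle :: "ugraph \<Rightarrow> nat list \<Rightarrow> bool" where
  "is_cycle G xs \<longleftrightarrow> length xs \<ge> 3 \<and> distinct xs \<and> set xs \<subseteq> verts G \<and>
     (\<forall>i<length xs. adj G (xs ! i) (xs ! ((i + 1) mod length xs)))"

definition is_tree :: "ugraph \<Rightarrow> bool" where
  "is_tree T \<longleftrightarrow> is_graph T \<and> verts T \<noteq> {} \<and> connected_in T (verts T) \<and>
     \<not> (\<exists>xs. is_cycle T xs)"

definition tree_decomposition :: "ugraph \<Rightarrow> ugraph \<Rightarrow> (nat \<Rightarrow> nat set) \<Rightarrow> bool" where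
  "tree_decomposition G T B \<longleftrightarrow> is_tree T \<and>
     (\<forall>t\<in>verts T. B t \<subseteq> verts G) \<and>
     (\<forall>v\<in>verts G. \<exists>t\<in>verts T. v \<in> B t) \<and>
     (\<forall>u v. adj G u v \<longrightarrow> (\<exists>t\<in>verts T. u \<in> B t \<and> v \<in> B t)) \<and>
     (\<forall>v\<in>verts G. connected_in T {t\<in>verts T. v \<in> B t})"

definition td_width :: "ugraph \<Rightarrow> (nat \<Rightarrow> nat set) \<Rightarrow> nat" where
  "td_width T B = Max ((\<lambda>t. card (B t)) ` verts T) - 1"

definition treewidth :: "ugraph \<Rightarrow> nat" where
  "treewidth G = (LEAST w. \<exists>T B. tree_decomposition G T B \<and> td_width T B = w)"

definition H_partition :: "ugraph \<Rightarrow> ugraph \<Rightarrow> (nat \<Rightarrow> nat set) \<Rightarrow> bool" where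
  "H_partition G H P \<longleftrightarrow>
     (\<forall>x\<in>verts H. P x \<subseteq> verts G) \<and>
     (\<Union>x\<in>verts H. P x) = verts G \<and>
     (\<forall>x\<in>verts H. \<forall>y\<in>verts H. x \<noteq> y \<longrightarrow> P x \<inter> P y = {}) \<and>
     (\<forall>x\<in>verts H. \<forall>y\<in>verts H. \<forall>v\<in>P x. \<forall>w\<in>P y.
        adj G v w \<longrightarrow> x = y \<or> adj H x y)"

definition partition_width :: "ugraph \<Rightarrow> (nat \<Rightarrow> nat set) \<Rightarrow> nat" where
  "partition_width H P = Max (insert 0 ((\<lambda>x. card (P x)) ` verts H))"

definition tpw :: "nat \<Rightarrow> ugraph \<Rightarrow> nat" where
  "tpw c G = (LEAST k. \<exists>H P. is_graph H \<and> treewidth H \<le> c \<and> H_partition G H P \<and>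
                              partition_width H P = k)"

definition underlying_treewidth :: "ugraph set \<Rightarrow> enat" where
  "underlying_treewidth \<G> =
     (if \<exists>c. \<exists>f::nat \<Rightarrow> nat. \<forall>G\<in>\<G>. tpw c G \<le> f (treewidth G)
      then enat (LEAST c. \<exists>f::nat \<Rightarrow> nat. \<forall>G\<in>\<G>. tpw c G \<le> f (treewidth G))
      else \<infinity>)"

definition nbhd :: "ugraph \<Rightarrow> nat set \<Rightarrow> nat set" where
  "nbhd G B = {v. \<exists>b\<in>B. adj G v b}"

definition l_partition :: "ugraph \<Rightarrow> nat \<Rightarrow> nat set set \<Rightarrow> bool" where
  "l_partition G l \<beta> \<longleftrightarrow> (\<forall>B\<in>\<beta>. B \<subseteq> verts G \<and> card B \<le> l) \<and>
     (\<forall>B1\<in>\<beta>. \<forall>B2\<in>\<beta>. B1 \<noteq> B2 \<longrightarrow> B1 \<inter> B2 = {}) \<and> \<Union>\<beta> = verts G"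

text \<open>Tuples in beta^c are lists of length c; index i (0-based) corresponds to B_(i+1).\<close>
definition disjointed :: "ugraph \<Rightarrow> nat \<Rightarrow> nat \<Rightarrow> nat set set \<Rightarrow> bool" where
  "disjointed G c d \<beta> \<longleftrightarrow>
     (\<forall>Bs. length Bs = c \<and> set Bs \<subseteq> \<beta> \<longrightarrow>
        (\<forall>X\<in>components G (verts G - \<Union>(set Bs)).
           \<exists>Q\<subseteq>X. card Q \<le> d \<and>
             (\<forall>Y\<in>components G (X - Q). \<exists>i<c.
                 Y \<inter> nbhd G (Bs ! i - \<Union>(set (take i Bs))) = {})))"

definition disjointed_width_property :: "ugraph set \<Rightarrow> nat \<Rightarrow> bool" where
  "disjointed_width_property \<G> c \<longleftrightarrow>
     (\<exists>g::nat \<Rightarrow> nat. (\<forall>n. g n \<ge> 1) \<and>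
        (\<forall>G\<in>\<G>. \<exists>\<beta>. l_partition G (g (treewidth G)) \<beta> \<and>
                      disjointed G c (g (treewidth G)) \<beta>))"

definition disjointed_treewidth :: "ugraph set \<Rightarrow> enat" where
  "disjointed_treewidth \<G> =
     (if \<exists>c. disjointed_width_property \<G> c
      then enat (LEAST c. disjointed_width_property \<G> c) else \<infinity>)"

end

theory Submission
  imports Defs "HOL-Library.FuncSet"
begin

text \<open>
  A graph has treewidth at most \<open>c\<close> iff it is a spanning subgraph of a chordal graph with all cliques of
  size at most \<open>c + 1\<close>, so trees can be replaced by perfect elimination orders.

  Given an \<open>H\<close>-partition with \<open>H\<close> chordal, the parts themselves form a disjointed partition: if the
  last eliminated vertex \<open>v\<close> is one of the \<open>c\<close> deleted vertices of \<open>H\<close>, its at most \<open>c\<close> neighbours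
  separate it from everything else; otherwise \<open>v\<close> is simplicial and can be ignored.

  Conversely, let \<open>\<beta>\<close> be a disjointed partition. Parts of \<open>G\<close> are removed one at a time, keeping every
  component \<open>X\<close> of the rest attached to at most \<open>c\<close> pairwise adjacent parts, and to each of them only
  through boundedly many elements of \<open>\<beta>\<close>. If there are \<open>c\<close> such parts, disjointedness gives a bounded
  \<open>Q \<subseteq> X\<close> such that each component of \<open>X - Q\<close> loses one of them. The new part is a bounded superset
  of \<open>Q\<close>, chosen by means of the bounded treewidth of \<open>G\<close> so that each component of the remainder is
  attached to it, too, only through boundedly many elements of \<open>\<beta>\<close>.
\<close>

subsection \<open>Connectedness\<close>

lemma adj_sym: "adj G u v \<longleftrightarrow> adj G v u"
  by (auto simp: adj_def insert_commute)

lemma adj_irrefl [simp]: "\<not> adj G u u"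
  by (simp add: adj_def)

lemma adj_verts: "is_graph G \<Longrightarrow> adj G u v \<Longrightarrow> u \<in> verts G \<and> v \<in> verts G"
  unfolding is_graph_def adj_def by (metis doubleton_eq_iff)

text \<open>A walk cannot leave a set closed under adjacency, and conversely the set reachable from
  a vertex is closed. Connectedness thus becomes a statement about closed subsets, used below
  instead of walks.\<close>

lemma connected_in_iff:
  "connected_in G W \<longleftrightarrow>
     (\<forall>A. A \<subseteq> W \<and> A \<noteq> {} \<and> (\<forall>x\<in>A. \<forall>y\<in>W. adj G x y \<longrightarrow> y \<in> A) \<longrightarrow> A = W)"
  (is "_ = ?R")
proof
  assume con: "connected_in G W"
  show ?R
  proof (intro allI impI)
    fix A assume A: "A \<subseteq> W \<and> A \<noteq> {} \<and> (\<forall>x\<in>A. \<forall>y\<in>W. adj G x y \<longrightarrow> y \<in> A)"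
    then obtain a where a: "a \<in> A" by auto
    have "y \<in> A" if "y \<in> W" for y
    proof -
      have "(\<lambda>x y. x \<in> W \<and> y \<in> W \<and> adj G x y)\<^sup>*\<^sup>* a y"
        using con A a that unfolding connected_in_def by blast
      then show ?thesis by (induction rule: rtranclp_induct) (use a A in auto)
    qed
    then show "A = W" using A by auto
  qed
next
  assume r: ?R
  show "connected_in G W"
    unfolding connected_in_def
  proof (intro ballI)
    fix u v assume uv: "u \<in> W" "v \<in> W"
    let ?A = "{x \<in> W. (\<lambda>x y. x \<in> W \<and> y \<in> W \<and> adj G x y)\<^sup>*\<^sup>* u x}"
    have "u \<in> ?A" using uv by auto
    moreover have "\<forall>x\<in>?A. \<forall>y\<in>W. adj G x y \<longrightarrow> y \<in> ?A"
      by (auto intro: rtranclp.rtrancl_into_rtrancl)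
    ultimately have "?A = W" using r[rule_format, of ?A] by blast
    then show "(\<lambda>x y. x \<in> W \<and> y \<in> W \<and> adj G x y)\<^sup>*\<^sup>* u v" using uv by auto
  qed
qed

lemma connected_inI:
  assumes "\<And>A. A \<subseteq> W \<Longrightarrow> A \<noteq> {} \<Longrightarrow> (\<And>x y. x \<in> A \<Longrightarrow> y \<in> W \<Longrightarrow> adj G x y \<Longrightarrow> y \<in> A) \<Longrightarrow> W \<subseteq> A"
  shows "connected_in G W"
  unfolding connected_in_iff using assms by (metis subset_antisym)

lemma connected_inD:
  assumes "connected_in G W" "A \<subseteq> W" "A \<noteq> {}" "\<And>x y. x \<in> A \<Longrightarrow> y \<in> W \<Longrightarrow> adj G x y \<Longrightarrow> y \<in> A"
  shows "W \<subseteq> A"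
  using assms unfolding connected_in_iff by (metis subset_refl)

lemma connected_in_mono:
  assumes "connected_in G W" "\<And>x y. x \<in> W \<Longrightarrow> y \<in> W \<Longrightarrow> adj G x y \<Longrightarrow> adj G' x y"
  shows "connected_in G' W"
proof (rule connected_inI)
  fix A assume A: "A \<subseteq> W" "A \<noteq> {}" and cl: "\<And>x y. x \<in> A \<Longrightarrow> y \<in> W \<Longrightarrow> adj G' x y \<Longrightarrow> y \<in> A"
  show "W \<subseteq> A"
    by (rule connected_inD[OF assms(1) A]) (use A cl assms(2) in blast)
qed

lemma connected_in_empty [simp]: "connected_in G {}"
  by (simp add: connected_in_def)

lemma connected_in_singleton [simp]: "connected_in G {x}"
  by (simp add: connected_in_def)

lemma connected_in_Un:
  assumes "connected_in G A" "connected_in G B" "A \<inter> B \<noteq> {}"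
  shows "connected_in G (A \<union> B)"
proof (rule connected_inI)
  fix C assume C: "C \<subseteq> A \<union> B" "C \<noteq> {}"
    and cl: "\<And>x y. x \<in> C \<Longrightarrow> y \<in> A \<union> B \<Longrightarrow> adj G x y \<Longrightarrow> y \<in> C"
  have 1: "A \<subseteq> C" if "C \<inter> A \<noteq> {}"
    using connected_inD[OF assms(1), of "C \<inter> A"] that cl by auto
  have 2: "B \<subseteq> C" if "C \<inter> B \<noteq> {}"
    using connected_inD[OF assms(2), of "C \<inter> B"] that cl by auto
  show "A \<union> B \<subseteq> C" using 1 2 C assms(3) by blast
qed

lemma connected_in_Un_neighbours:
  assumes "connected_in G A" "A \<noteq> {}" "\<And>b. b \<in> B \<Longrightarrow> b \<in> A \<or> (\<exists>a\<in>A. adj G a b)"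
  shows "connected_in G (A \<union> B)"
proof (rule connected_inI)
  fix C assume C: "C \<subseteq> A \<union> B" "C \<noteq> {}"
    and cl: "\<And>x y. x \<in> C \<Longrightarrow> y \<in> A \<union> B \<Longrightarrow> adj G x y \<Longrightarrow> y \<in> C"
  have "C \<inter> A \<noteq> {}"
  proof -
    obtain x where "x \<in> C" using C by auto
    then show ?thesis using C assms(3)[of x] cl[of x] adj_sym[THEN iffD1] by blast
  qed
  then have "A \<subseteq> C"
    using connected_inD[OF assms(1), of "C \<inter> A"] cl by auto
  then show "A \<union> B \<subseteq> C" using assms(3) cl by blast
qed

lemma connected_in_insert:
  assumes "connected_in G A" "a \<in> A" "adj G a b"
  shows "connected_in G (insert b A)"
  using connected_in_Un_neighbours[of G A "{b}"] assms by auto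

definition clique :: "ugraph \<Rightarrow> nat set \<Rightarrow> bool" where
  "clique G K \<longleftrightarrow> (\<forall>x\<in>K. \<forall>y\<in>K. x \<noteq> y \<longrightarrow> adj G x y)"

text \<open>Two neighbours of \<open>v\<close> in \<open>W\<close> are equal or adjacent, so a walk
  through \<open>v\<close> can bypass it. In the proof, a closed set that meets the neighbours of
  \<open>v\<close> contains all of them.\<close>

lemma connected_in_remove_simplicial:
  assumes con: "connected_in G W" and K: "clique G {y \<in> W. adj G v y}"
  shows "connected_in G (W - {v})"
proof (rule connected_inI)
  fix A assume A: "A \<subseteq> W - {v}" "A \<noteq> {}"
    and cl: "\<And>x y. x \<in> A \<Longrightarrow> y \<in> W - {v} \<Longrightarrow> adj G x y \<Longrightarrow> y \<in> A"
  show "W - {v} \<subseteq> A"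
  proof (cases "\<exists>a\<in>A. adj G v a")
    case True
    then obtain a where a: "a \<in> A" "adj G v a" by auto
    have nb: "y \<in> A" if "y \<in> W" "adj G v y" for y
    proof (cases "y = a")
      case False
      have "a \<in> W" "y \<noteq> v" using a A that by auto
      then have "adj G a y" using K[unfolded clique_def, rule_format, of a y] that a False by simp
      then show ?thesis using cl a that \<open>y \<noteq> v\<close> by blast
    qed (use a in auto)
    \<comment> \<open>\<open>v\<close> may lie outside \<open>W\<close>, hence the
      intersection.\<close>
    have "W \<subseteq> insert v A \<inter> W"
    proof (rule connected_inD[OF con])
      show "insert v A \<inter> W \<noteq> {}" using A by auto
      fix x y assume "x \<in> insert v A \<inter> W" "y \<in> W" "adj G x y"
      then show "y \<in> insert v A \<inter> W" using nb cl by auto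
    qed auto
    then show ?thesis by auto
  next
    case False
    have "W \<subseteq> A"
    proof (rule connected_inD[OF con])
      fix x y assume "x \<in> A" "y \<in> W" "adj G x y"
      then show "y \<in> A" using False cl adj_sym[of G x y] by auto
    qed (use A in auto)
    then show ?thesis by auto
  qed
qed

text \<open>By finiteness a maximal connected superset exists. Later arguments speak of all nonempty
  connected sets, because separation passes to subsets; this lemma leads back to components.\<close>

lemma connected_in_component:
  assumes "finite W" "C \<subseteq> W" "C \<noteq> {}" "connected_in G C"
  obtains X where "X \<in> components G W" "C \<subseteq> X"
proof -
  let ?F = "{D. C \<subseteq> D \<and> D \<subseteq> W \<and> connected_in G D}"
  have "finite ?F" "C \<in> ?F" using assms by (auto intro: finite_subset[of _ "Pow W"])
  from finite_has_maximal2[OF this] obtain X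
    where X: "X \<in> ?F" "\<forall>D\<in>?F. X \<subseteq> D \<longrightarrow> X = D" by auto
  have "X \<in> components G W"
    unfolding components_def
  proof (intro CollectI conjI allI impI)
    fix D assume "X \<subseteq> D \<and> D \<subseteq> W \<and> connected_in G D"
    then show "D = X" using X by auto
  qed (use X assms in auto)
  then show ?thesis using that X by simp
qed

lemma component_absorbs:
  assumes "X \<in> components G W" "Z \<subseteq> W" "connected_in G Z" "Z \<inter> X \<noteq> {}"
  shows "Z \<subseteq> X"
proof -
  have "connected_in G (X \<union> Z)"
    using assms connected_in_Un[of G X Z] unfolding components_def by blast
  then show ?thesis using assms unfolding components_def by blast
qed

lemma component_absorbs_neighbour:
  assumes "X \<in> components G W" "x \<in> X" "y \<in> W" "adj G x y"
  shows "y \<in> X"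
proof -
  have "connected_in G (insert y X)"
    using assms connected_in_insert[of G X x y] unfolding components_def by blast
  then show ?thesis using assms unfolding components_def by blast
qed

subsection \<open>Chordal graphs and treewidth\<close>

text \<open>\<open>K\<close> is left arbitrary: with a clique \<open>K\<close> this is one step of
  an elimination order, with \<open>K = {s}\<close> it attaches a leaf to a tree.\<close>

definition add_simplicial :: "nat \<Rightarrow> nat set \<Rightarrow> ugraph \<Rightarrow> ugraph" where
  "add_simplicial v K G = (insert v (verts G), edges G \<union> (\<lambda>x. {v, x}) ` K)"

lemma verts_add_simplicial [simp]: "verts (add_simplicial v K G) = insert v (verts G)"
  by (simp add: add_simplicial_def verts_def)

lemma adj_add_simplicial:
  assumes "v \<notin> K"
  shows "adj (add_simplicial v K G) x y \<longleftrightarrow> adj G x y \<or> x = v \<and> y \<in> K \<or> y = v \<and> x \<in> K"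
  using assms by (auto simp: add_simplicial_def adj_def edges_def doubleton_eq_iff)

text \<open>The chordal graphs without cliques of size \<open>c + 2\<close>, through a perfect elimination order.\<close>

inductive chordal :: "nat \<Rightarrow> ugraph \<Rightarrow> bool" for c where
  empty: "chordal c ({}, {})"
| add: "chordal c G \<Longrightarrow> v \<notin> verts G \<Longrightarrow> K \<subseteq> verts G \<Longrightarrow> clique G K \<Longrightarrow> card K \<le> c
        \<Longrightarrow> chordal c (add_simplicial v K G)"

lemma chordal_is_graph: "chordal c G \<Longrightarrow> is_graph G"
proof (induction rule: chordal.induct)
  case empty
  show ?case by (simp add: is_graph_def verts_def edges_def)
next
  case (add G v K)
  have "edges (add_simplicial v K G) = edges G \<union> (\<lambda>x. {v, x}) ` K"
    by (simp add: add_simplicial_def edges_def)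
  moreover have "\<exists>a b. {v, x} = {a, b} \<and> a \<noteq> b \<and> a \<in> insert v (verts G) \<and> b \<in> insert v (verts G)"
    if "x \<in> K" for x
    by (rule exI[of _ v], rule exI[of _ x]) (use that add.hyps in auto)
  moreover have "\<forall>e\<in>edges G. \<exists>a b. e = {a, b} \<and> a \<noteq> b \<and> a \<in> insert v (verts G) \<and> b \<in> insert v (verts G)"
    using add.IH unfolding is_graph_def by blast
  ultimately show ?case using add.IH unfolding is_graph_def by auto
qed

lemma chordal_finite: "chordal c G \<Longrightarrow> finite (verts G)"
  using chordal_is_graph is_graph_def by blast

section \<open>From tree decompositions to chordal supergraphs\<close>

lemma clique_subset: "clique G K \<Longrightarrow> L \<subseteq> K \<Longrightarrow> clique G L"
  unfolding clique_def by blast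

lemma clique_insert: "clique G (insert v K) \<longleftrightarrow> clique G K \<and> (\<forall>x\<in>K. x \<noteq> v \<longrightarrow> adj G v x)"
  unfolding clique_def by (auto simp: adj_sym[of G _ v])

text \<open>The vertices of \<open>F\<close> are added one after another, each joined to
  \<open>S\<close> and to those added before. These are at most \<open>c\<close> because
  \<open>S\<close> and \<open>F\<close> together have at most \<open>c + 1\<close> elements.\<close>

lemma chordal_add_clique:
  assumes "finite F"
  shows "chordal c G \<Longrightarrow> S \<subseteq> verts G \<Longrightarrow> clique G S \<Longrightarrow> F \<inter> verts G = {} \<Longrightarrow> card (S \<union> F) \<le> Suc c \<Longrightarrow>
    \<exists>J. chordal c J \<and> verts J = verts G \<union> F \<and> (\<forall>x y. adj G x y \<longrightarrow> adj J x y) \<and> clique J (S \<union> F)"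
  using assms
proof (induction F rule: finite_induct)
  case empty
  then show ?case by (intro exI[of _ G]) auto
next
  case (insert v F)
  have fS: "finite S" using insert.prems chordal_finite finite_subset by blast
  have vn: "v \<notin> S \<union> F" using insert by auto
  then have card: "card (S \<union> F) \<le> c" using insert.prems(5) fS insert.hyps(1) by auto
  then obtain J where J: "chordal c J" "verts J = verts G \<union> F" "\<forall>x y. adj G x y \<longrightarrow> adj J x y" "clique J (S \<union> F)"
    using insert.IH[OF insert.prems(1-3)] insert.prems(4) by auto
  let ?J = "add_simplicial v (S \<union> F) J"
  have "chordal c ?J" by (rule chordal.add) (use J insert card in auto)
  moreover have "clique ?J (insert v (S \<union> F))"
    using J(4) vn by (auto simp: clique_insert adj_add_simplicial clique_def)
  ultimately show ?case using J vn
    by (intro exI[of _ ?J]) (auto simp: adj_add_simplicial)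
qed

text \<open>Take a longest path in \<open>S\<close>: a further neighbour in \<open>S\<close> of its
  first vertex \<open>t\<close> either prolongs the path or closes a cycle.\<close>

lemma acyclic_leaf:
  assumes acyclic: "\<not> (\<exists>xs. is_cycle T xs)" and S: "finite S" "S \<subseteq> verts T" "connected_in T S"
    and ab: "a \<in> S" "b \<in> S" "a \<noteq> b"
  obtains t s where "t \<in> S" "s \<in> S" "t \<noteq> s" "\<And>y. y \<in> S \<Longrightarrow> adj T t y \<Longrightarrow> y = s"
proof -
  define path where "path p \<longleftrightarrow> distinct p \<and> set p \<subseteq> S \<and> length p \<ge> 2 \<and>
    (\<forall>i. Suc i < length p \<longrightarrow> adj T (p ! i) (p ! Suc i))" for p
  obtain y where y: "y \<in> S" "adj T a y"
    using connected_inD[OF S(3), of "{a}"] ab by auto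
  have "path [a, y]"
    using ab y by (auto simp: path_def)
  moreover have "length p \<le> card S" if "path p" for p
    using that S(1) card_mono[of S "set p"] by (simp add: path_def distinct_card)
  ultimately obtain p where p: "path p" and max: "\<And>q. path q \<Longrightarrow> length q \<le> length p"
    using ex_has_greatest_nat[of path "[a, y]" length "Suc (card S)"] by (metis le_imp_less_Suc)
  obtain t s r where tsr: "p = t # s # r"
    using p unfolding path_def by (cases p; cases "tl p") auto
  have "x = s" if x: "x \<in> S" "adj T t x" for x
  proof (rule ccontr)
    assume "x \<noteq> s"
    show False
    proof (cases "x \<in> set p")
      case False
      have "adj T ((x # p) ! i) ((x # p) ! Suc i)" if "Suc i < length (x # p)" for i
        using that p x adj_sym[of T t x] tsr unfolding path_def by (cases i) auto
      then have "path (x # p)" using False p x unfolding path_def by auto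
      then show False using max by fastforce
    next
      case True
      then obtain j where j: "j < length p" "p ! j = x" by (auto simp: in_set_conv_nth)
      have "j \<noteq> 0" using j x tsr by (cases "j = 0") auto
      moreover have "j \<noteq> 1" using j \<open>x \<noteq> s\<close> tsr by auto
      ultimately have "j \<ge> 2" by simp
      \<comment> \<open>Since \<open>j\<close> is at least 2, the initial segment up to
        \<open>x\<close> is a cycle of length at least 3.\<close>
      have "adj T (take (Suc j) p ! i) (take (Suc j) p ! ((i + 1) mod Suc j))" if "i < Suc j" for i
      proof (cases "i = j")
        case True
        have "take (Suc j) p ! j = x" "take (Suc j) p ! 0 = p ! 0" using j by simp_all
        moreover have "p ! 0 = t" using tsr by simp
        ultimately show ?thesis using True x adj_sym[of T t x] by simp
      next
        case False
        then have "i < j" using that by simp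
        then show ?thesis using p j unfolding path_def by simp
      qed
      then have "is_cycle T (take (Suc j) p)"
        using p S(2) j \<open>j \<ge> 2\<close> unfolding is_cycle_def path_def
        by (auto dest: in_set_takeD)
      then show False using acyclic by blast
    qed
  qed
  moreover have "t \<in> S" "s \<in> S" "t \<noteq> s" using p tsr unfolding path_def by auto
  ultimately show ?thesis using that by blast
qed

text \<open>Induction on the subtree \<open>S\<close>, removing a leaf \<open>t\<close> with
  neighbour \<open>s\<close>. Vertices of \<open>B t\<close> that occur in another bag lie in
  \<open>B s\<close>, hence form a clique already built, and \<open>chordal_add_clique\<close> adds
  the rest of \<open>B t\<close>.\<close>

lemma tree_bags_chordal:
  assumes acyclic: "\<not> (\<exists>xs. is_cycle T xs)" and "finite S"
  shows "S \<noteq> {} \<Longrightarrow> S \<subseteq> verts T \<Longrightarrow> connected_in T S \<Longrightarrow>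
    (\<And>t. t \<in> S \<Longrightarrow> finite (B t) \<and> card (B t) \<le> Suc c) \<Longrightarrow>
    (\<And>v. connected_in T {t \<in> S. v \<in> B t}) \<Longrightarrow>
    \<exists>J. chordal c J \<and> verts J = (\<Union>t\<in>S. B t) \<and> (\<forall>t\<in>S. clique J (B t))"
  using assms(2)
proof (induction S rule: finite_psubset_induct)
  case (psubset S)
  note bag = psubset.prems(4)
  show ?case
  proof (cases "\<exists>a b. a \<in> S \<and> b \<in> S \<and> a \<noteq> b")
    case False
    then obtain t where t: "S = {t}" using psubset.prems(1) by blast
    \<comment> \<open>A single bag is a clique added to the empty graph.\<close>
    have "\<exists>J. chordal c J \<and> verts J = verts ({}, {}) \<union> B t \<and>
        (\<forall>x y. adj ({}, {}) x y \<longrightarrow> adj J x y) \<and> clique J ({} \<union> B t)"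
      by (rule chordal_add_clique) (use bag[of t] t in \<open>auto simp: chordal.empty clique_def verts_def\<close>)
    then show ?thesis using t by (auto simp: verts_def)
  next
    case True
    then obtain a b where "a \<in> S" "b \<in> S" "a \<noteq> b" by blast
    then obtain t s where ts: "t \<in> S" "s \<in> S" "t \<noteq> s" "\<And>y. y \<in> S \<Longrightarrow> adj T t y \<Longrightarrow> y = s"
      using acyclic_leaf[OF acyclic psubset.hyps psubset.prems(2,3)] by blast
    have simp: "connected_in T (W - {t})" if "W \<subseteq> S" "connected_in T W" for W
    proof (rule connected_in_remove_simplicial[OF that(2)])
      show "clique T {y \<in> W. adj T t y}" using ts(4) that(1) unfolding clique_def by blast
    qed
    have "\<exists>J. chordal c J \<and> verts J = (\<Union>t\<in>S - {t}. B t) \<and> (\<forall>t\<in>S - {t}. clique J (B t))"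
    proof (rule psubset.IH)
      show "S - {t} \<subset> S" "S - {t} \<noteq> {}" "S - {t} \<subseteq> verts T" using ts psubset.prems(2) by auto
      show "connected_in T (S - {t})" using simp[of S] psubset.prems(3) by simp
      show "connected_in T {x \<in> S - {t}. v \<in> B x}" for v
      proof -
        have "{x \<in> S - {t}. v \<in> B x} = {x \<in> S. v \<in> B x} - {t}" by auto
        then show ?thesis using simp[of "{x \<in> S. v \<in> B x}"] psubset.prems(5)[of v] by auto
      qed
      show "finite (B x) \<and> card (B x) \<le> Suc c" if "x \<in> S - {t}" for x using bag that by blast
    qed
    then obtain J where J: "chordal c J" "verts J = (\<Union>t\<in>S - {t}. B t)" "\<forall>t\<in>S - {t}. clique J (B t)" by blast
    have sub: "B t \<inter> verts J \<subseteq> B s"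
    proof
      fix v assume v: "v \<in> B t \<inter> verts J"
      then obtain r where r: "r \<in> S" "r \<noteq> t" "v \<in> B r" using J(2) by auto
      show "v \<in> B s"
      proof (rule ccontr)
        assume "v \<notin> B s"
        \<comment> \<open>The only possible neighbour of \<open>t\<close> in \<open>S\<close> is
          \<open>s\<close>, so \<open>{t}\<close> would be closed within the nodes whose bags
          contain \<open>v\<close>.\<close>
        then have "{x \<in> S. v \<in> B x} \<subseteq> {t}"
          using connected_inD[OF psubset.prems(5)[of v], of "{t}"] ts(1,4) v by auto
        then show False using r by auto
      qed
    qed
    have un: "(B t \<inter> B s) \<union> (B t - verts J) = B t" using sub by auto
    have "\<exists>J'. chordal c J' \<and> verts J' = verts J \<union> (B t - verts J) \<and>
        (\<forall>x y. adj J x y \<longrightarrow> adj J' x y) \<and> clique J' ((B t \<inter> B s) \<union> (B t - verts J))"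
    proof (rule chordal_add_clique[OF _ J(1)])
      show "clique J (B t \<inter> B s)" using J(3) ts clique_subset[of J "B s"] by auto
      show "B t \<inter> B s \<subseteq> verts J" using J(2) ts by auto
      show "card ((B t \<inter> B s) \<union> (B t - verts J)) \<le> Suc c" unfolding un using bag[OF ts(1)] by simp
      show "finite (B t - verts J)" using bag[OF ts(1)] by simp
    qed auto
    then obtain J' where J': "chordal c J'" "verts J' = verts J \<union> (B t - verts J)"
        "\<forall>x y. adj J x y \<longrightarrow> adj J' x y" "clique J' (B t)" unfolding un by blast
    have "verts J' = (\<Union>t\<in>S. B t)" using J'(2) J(2) ts(1) by auto
    moreover have "\<forall>t\<in>S. clique J' (B t)" using J'(3,4) J(3) unfolding clique_def by (metis DiffI singletonD)
    ultimately show ?thesis using J'(1) by blast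
  qed
qed

section \<open>From chordal graphs to tree decompositions\<close>

lemma singleton_is_tree: "is_tree ({n}, {})"
proof -
  have "\<not> is_cycle ({n}, {}) xs" for xs
  proof
    assume "is_cycle ({n}, {}) xs"
    then have "3 \<le> length xs"
      and "\<forall>i<length xs. adj ({n}, {}) (xs ! i) (xs ! ((i + 1) mod length xs))"
      unfolding is_cycle_def by auto
    from this(2)[rule_format, of 0] this(1) show False by (cases "xs = []") (auto simp: adj_def edges_def)
  qed
  then show ?thesis by (simp add: is_tree_def is_graph_def verts_def edges_def)
qed

lemma single_bag_tree_decomposition:
  assumes "is_graph G"
  shows "tree_decomposition G ({n}, {}) (\<lambda>_. verts G)"
  using adj_verts[OF assms] singleton_is_tree by (auto simp: tree_decomposition_def verts_def)

text \<open>On a cycle through \<open>n\<close>, both neighbours of \<open>n\<close> would have to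
  be \<open>s\<close>; a cycle avoiding \<open>n\<close> already lies in \<open>T\<close>.\<close>

lemma tree_add_leaf:
  assumes T: "is_tree T" and n: "n \<notin> verts T" and s: "s \<in> verts T"
  shows "is_tree (add_simplicial n {s} T)" (is "is_tree ?T")
proof -
  have ns: "n \<notin> {s}" using n s by auto
  have gT: "is_graph T" and cT: "connected_in T (verts T)" using T by (auto simp: is_tree_def)
  have "is_graph ?T"
  proof -
    have "edges ?T = edges T \<union> {{n, s}}"
      by (simp add: add_simplicial_def edges_def)
    moreover have "\<forall>e\<in>edges T. \<exists>a b. e = {a, b} \<and> a \<noteq> b \<and> a \<in> insert n (verts T) \<and> b \<in> insert n (verts T)"
      using gT unfolding is_graph_def by blast
    ultimately show ?thesis using gT ns s unfolding is_graph_def by auto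
  qed
  moreover have "connected_in ?T (verts ?T)"
    unfolding verts_add_simplicial
    by (rule connected_in_insert[of _ _ s])
      (use s ns connected_in_mono[OF cT, of ?T] in \<open>auto simp: adj_add_simplicial\<close>)
  moreover have "\<not> is_cycle ?T xs" for xs
  proof
    assume c: "is_cycle ?T xs"
    let ?l = "length xs"
    have l: "?l \<ge> 3" "distinct xs" "set xs \<subseteq> insert n (verts T)"
      and step: "\<And>i. i < ?l \<Longrightarrow> adj ?T (xs ! i) (xs ! ((i + 1) mod ?l))"
      using c by (auto simp: is_cycle_def)
    show False
    proof (cases "n \<in> set xs")
      case True
      then obtain i where i: "i < ?l" "xs ! i = n" by (auto simp: in_set_conv_nth)
      define j where "j = (i + 1) mod ?l"
      \<comment> \<open>The cyclic predecessor of \<open>i\<close>; it differs from the successor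
        \<open>j\<close> because a cycle has at least three vertices.\<close>
      define h where "h = (if i = 0 then ?l - 1 else i - 1)"
      have h: "h < ?l" "(h + 1) mod ?l = i" using i l by (auto simp: h_def)
      have j: "j < ?l" using i unfolding j_def by (intro mod_less_divisor) linarith
      have "j \<noteq> h"
      proof (cases "i + 1 = ?l")
        case True
        then show ?thesis using l(1) by (auto simp: j_def h_def)
      next
        case False
        then have "j = i + 1" using i unfolding j_def by simp
        then show ?thesis using l(1) by (auto simp: h_def)
      qed
      have only: "x = s" if "adj ?T n x" for x
        using that n adj_verts[OF gT] by (auto simp: adj_add_simplicial[OF ns])
      have "xs ! j = s" using step[OF i(1)] only i(2) unfolding j_def by auto
      moreover have "xs ! h = s" using step[OF h(1)] only i(2) h(2) adj_sym by metis
      ultimately show False using \<open>j \<noteq> h\<close> j h(1) l(2) nth_eq_iff_index_eq[of xs j h] by auto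
    next
      case False
      have "adj T (xs ! i) (xs ! ((i + 1) mod ?l))" if "i < ?l" for i
      proof -
        have "(i + 1) mod ?l < ?l" using that by (intro mod_less_divisor) linarith
        then have "xs ! i \<noteq> n" "xs ! ((i + 1) mod ?l) \<noteq> n"
          using False that nth_mem by blast+
        then show ?thesis using step[OF that] by (simp add: adj_add_simplicial[OF ns])
      qed
      then have "is_cycle T xs" using l False by (auto simp: is_cycle_def)
      then show False using T by (auto simp: is_tree_def)
    qed
  qed
  ultimately show ?thesis by (simp add: is_tree_def)
qed

text \<open>The claim about cliques makes the induction work: the clique \<open>K\<close> lies in
  some bag \<open>B s\<close>, and the new bag \<open>insert v K\<close> is attached to
  \<open>s\<close> as a leaf.\<close>

lemma chordal_clique_tree:
  "chordal c G \<Longrightarrow> \<exists>T B. is_tree T \<and> (\<forall>t\<in>verts T. B t \<subseteq> verts G \<and> card (B t) \<le> Suc c) \<and>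
     (\<forall>K\<subseteq>verts G. clique G K \<longrightarrow> (\<exists>t\<in>verts T. K \<subseteq> B t)) \<and>
     (\<forall>v\<in>verts G. connected_in T {t \<in> verts T. v \<in> B t})"
proof (induction rule: chordal.induct)
  case empty
  show ?case
    \<comment> \<open>A tree is never empty, so the empty graph gets one empty bag.\<close>
    by (rule exI[of _ "({0}, {})"], rule exI[of _ "\<lambda>_. {}"])
      (auto simp: singleton_is_tree, auto simp: verts_def)
next
  case (add G v K)
  from add.IH obtain T B where T: "is_tree T" and bag: "\<forall>t\<in>verts T. B t \<subseteq> verts G \<and> card (B t) \<le> Suc c"
    and cl: "\<forall>K\<subseteq>verts G. clique G K \<longrightarrow> (\<exists>t\<in>verts T. K \<subseteq> B t)"
    and con: "\<forall>v\<in>verts G. connected_in T {t \<in> verts T. v \<in> B t}"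
    by (elim exE conjE) (rule that)
  have fin: "finite (verts T)" "finite (verts G)"
    using T chordal_finite add.hyps by (auto simp: is_tree_def is_graph_def)
  obtain s where s: "s \<in> verts T" "K \<subseteq> B s" using cl add.hyps by blast
  obtain n where n: "n \<notin> verts T" using ex_new_if_finite[OF infinite_UNIV_nat fin(1)] by blast
  then have ns: "n \<notin> {s}" using s by auto
  let ?T = "add_simplicial n {s} T" and ?B = "B(n := insert v K)" and ?G = "add_simplicial v K G"
  have vK: "v \<notin> K" using add.hyps by auto
  have finK: "finite K" using fin add.hyps finite_subset by blast
  have treeT: "is_tree ?T" by (rule tree_add_leaf[OF T n s(1)])
  have bags: "\<forall>t\<in>verts ?T. ?B t \<subseteq> verts ?G \<and> card (?B t) \<le> Suc c"
  proof
    fix t assume "t \<in> verts ?T"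
    then show "?B t \<subseteq> verts ?G \<and> card (?B t) \<le> Suc c"
      using bag add.hyps n vK finK by auto
  qed
  have cliques: "\<exists>t\<in>verts ?T. L \<subseteq> ?B t" if L: "L \<subseteq> verts ?G" "clique ?G L" for L
  proof (cases "v \<in> L")
    case True
    have "x \<in> K" if "x \<in> L" "x \<noteq> v" for x
    proof -
      have "adj ?G v x" using L(2)[unfolded clique_def, rule_format, of v x] True that by simp
      moreover have "\<not> adj G v x"
        using adj_verts[OF chordal_is_graph[OF add.hyps(1)], of v x] add.hyps(2) by blast
      ultimately show ?thesis using that vK by (simp add: adj_add_simplicial)
    qed
    then show ?thesis by (intro bexI[of _ n]) auto
  next
    case False
    then have "clique G L" "L \<subseteq> verts G" using L vK by (auto simp: clique_def adj_add_simplicial)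
    then obtain t where "t \<in> verts T" "L \<subseteq> B t" using cl by blast
    then show ?thesis using n by (intro bexI[of _ t]) auto
  qed
  have cons: "connected_in ?T {t \<in> verts ?T. x \<in> ?B t}" if x: "x \<in> verts ?G" for x
  proof (cases "x = v")
    case True
    then have "{t \<in> verts ?T. x \<in> ?B t} = {n}" using bag add.hyps n by auto
    then show ?thesis by simp
  next
    case False
    let ?W = "{t \<in> verts T. x \<in> B t}"
    have W: "connected_in ?T ?W"
      by (rule connected_in_mono[of T]) (use con x False ns in \<open>auto simp: adj_add_simplicial\<close>)
    show ?thesis
    proof (cases "x \<in> K")
      case True
      then have "{t \<in> verts ?T. x \<in> ?B t} = insert n ?W" using n by auto
      moreover have "connected_in ?T (insert n ?W)"
        by (rule connected_in_insert[OF W, of s]) (use s True ns in \<open>auto simp: adj_add_simplicial\<close>)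
      ultimately show ?thesis by simp
    next
      case False
      then have "{t \<in> verts ?T. x \<in> ?B t} = ?W" using n \<open>x \<noteq> v\<close> by auto
      then show ?thesis using W by simp
    qed
  qed
  show ?case using treeT bags cliques cons by blast
qed

text \<open>A clique tree of \<open>J\<close> is a tree decomposition of every spanning subgraph:
  cliques of one and two vertices cover the vertices and the edges.\<close>

lemma treewidth_le_if_chordal:
  assumes J: "chordal c J" and G: "verts G = verts J" "\<And>u v. adj G u v \<Longrightarrow> adj J u v"
  shows "treewidth G \<le> c"
proof -
  obtain T B where T: "is_tree T" and bag: "\<forall>t\<in>verts T. B t \<subseteq> verts J \<and> card (B t) \<le> Suc c"
    and cl: "\<forall>K\<subseteq>verts J. clique J K \<longrightarrow> (\<exists>t\<in>verts T. K \<subseteq> B t)"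
    and con: "\<forall>v\<in>verts J. connected_in T {t \<in> verts T. v \<in> B t}"
    using chordal_clique_tree[OF J] by (elim exE conjE) (rule that)
  have "\<exists>t\<in>verts T. v \<in> B t" if "v \<in> verts J" for v
    using cl[rule_format, of "{v}"] that by (auto simp: clique_def)
  moreover have "\<exists>t\<in>verts T. u \<in> B t \<and> v \<in> B t" if "adj G u v" for u v
  proof -
    have "adj J u v" using G that by blast
    then have "{u, v} \<subseteq> verts J" "clique J {u, v}"
      using adj_verts[OF chordal_is_graph[OF J], of u v] adj_sym[of J u v] by (auto simp: clique_def)
    then show ?thesis using cl[rule_format, of "{u, v}"] by simp
  qed
  ultimately have "tree_decomposition G T B"
    using T bag con unfolding tree_decomposition_def G(1) by blast
  then have "treewidth G \<le> td_width T B"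
    unfolding treewidth_def by (intro Least_le) blast
  also have "\<dots> \<le> c"
  proof -
    have "Max ((\<lambda>t. card (B t)) ` verts T) \<le> Suc c"
      using T bag by (intro Max.boundedI) (auto simp: is_tree_def is_graph_def)
    then show ?thesis by (simp add: td_width_def)
  qed
  finally show ?thesis .
qed

text \<open>Every bag of an optimal tree decomposition is turned into a clique.\<close>

lemma treewidth_le_imp_chordal:
  assumes G: "is_graph G" and "treewidth G \<le> c"
  obtains J where "chordal c J" "verts J = verts G" "\<And>u v. adj G u v \<Longrightarrow> adj J u v"
proof -
  have "\<exists>T B. tree_decomposition G T B \<and> td_width T B = treewidth G"
    unfolding treewidth_def
    \<comment> \<open>The minimum is attained: a single bag with all vertices is a tree
      decomposition.\<close>
    by (rule LeastI_ex) (use single_bag_tree_decomposition[OF G] in blast)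
  then obtain T B where td: "tree_decomposition G T B" and w: "td_width T B \<le> c" using assms by auto
  have T: "is_tree T" and sub: "\<forall>t\<in>verts T. B t \<subseteq> verts G"
    and cov: "\<forall>v\<in>verts G. \<exists>t\<in>verts T. v \<in> B t"
    and ed: "\<forall>u v. adj G u v \<longrightarrow> (\<exists>t\<in>verts T. u \<in> B t \<and> v \<in> B t)"
    and con: "\<forall>v\<in>verts G. connected_in T {t\<in>verts T. v \<in> B t}"
    using td unfolding tree_decomposition_def by blast+
  have fT: "finite (verts T)" using T by (simp add: is_tree_def is_graph_def)
  have "\<exists>J. chordal c J \<and> verts J = (\<Union>t\<in>verts T. B t) \<and> (\<forall>t\<in>verts T. clique J (B t))"
  proof (rule tree_bags_chordal)
    show "\<not> (\<exists>xs. is_cycle T xs)" "verts T \<noteq> {}" "connected_in T (verts T)" using T by (auto simp: is_tree_def)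
    show "finite (B t) \<and> card (B t) \<le> Suc c" if "t \<in> verts T" for t
    proof -
      have "card (B t) \<le> Max ((\<lambda>t. card (B t)) ` verts T)" using fT that by (intro Max_ge) auto
      moreover have "finite (B t)"
        using sub that G finite_subset[of "B t" "verts G"] unfolding is_graph_def by blast
      ultimately show ?thesis using w by (simp add: td_width_def)
    qed
    show "connected_in T {t \<in> verts T. v \<in> B t}" for v
    proof (cases "v \<in> verts G")
      case False
      then have "{t \<in> verts T. v \<in> B t} = {}" using sub by auto
      then show ?thesis by (metis connected_in_empty)
    qed (use con in blast)
  qed (use fT in auto)
  then obtain J where J: "chordal c J" "verts J = (\<Union>t\<in>verts T. B t)" "\<forall>t\<in>verts T. clique J (B t)" by blast
  have "verts J = verts G" using J(2) sub cov by blast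
  moreover have "adj J u v" if "adj G u v" for u v
  proof -
    have "u \<noteq> v" using that by (simp add: adj_def)
    then show ?thesis using ed that J(3) unfolding clique_def by blast
  qed
  ultimately show ?thesis using that J(1) by blast
qed

subsection \<open>From \<open>H\<close>-partitions to disjointed partitions\<close>

context
  fixes G :: ugraph and v :: nat and K :: "nat set"
  assumes G: "is_graph G" and v: "v \<notin> verts G" and K: "K \<subseteq> verts G" "clique G K"
begin

private lemma adj': "adj (add_simplicial v K G) x y \<longleftrightarrow> adj G x y \<or> x = v \<and> y \<in> K \<or> y = v \<and> x \<in> K"
  using v K by (intro adj_add_simplicial) blast

lemma adj_add_simplicial_new: "adj (add_simplicial v K G) v y \<longleftrightarrow> y \<in> K"
  using adj_verts[OF G, of v y] v K unfolding adj' by blast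

lemma adj_add_simplicial_old:
  "x \<noteq> v \<Longrightarrow> y \<noteq> v \<Longrightarrow> adj (add_simplicial v K G) x y \<longleftrightarrow> adj G x y"
  by (simp add: adj')

lemma connected_in_add_simplicial_remove:
  assumes "connected_in (add_simplicial v K G) Y"
  shows "connected_in G (Y - {v})"
proof (rule connected_in_mono)
  show "connected_in (add_simplicial v K G) (Y - {v})"
  proof (rule connected_in_remove_simplicial[OF assms], unfold adj_add_simplicial_new)
    show "clique (add_simplicial v K G) {y \<in> Y. y \<in> K}"
      using K(2) by (auto simp: clique_def adj')
  qed
qed (auto simp: adj_add_simplicial_old)

lemma connected_in_add_simplicial_meets:
  assumes "connected_in (add_simplicial v K G) Y" "v \<in> Y" "Y \<noteq> {v}"
  shows "\<exists>k\<in>K. k \<in> Y"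
proof (rule ccontr)
  assume "\<not> ?thesis"
  then have "Y \<subseteq> {v}"
    using connected_inD[OF assms(1), of "{v}"] assms(2) by (auto simp: adj_add_simplicial_new)
  then show False using assms by auto
qed

end

text \<open>Induction on the elimination order, for all connected \<open>Y\<close> rather than
  components so that the hypothesis applies to \<open>Y - {v}\<close>. The bound
  \<open>Suc c\<close> covers the at most \<open>c\<close> neighbours of \<open>v\<close> as well as
  the separator \<open>{v}\<close> used for \<open>X = {v}\<close>, even if
  \<open>c = 0\<close>.\<close>

lemma chordal_separate:
  "chordal c J \<Longrightarrow> C \<subseteq> verts J \<Longrightarrow> card C = c \<Longrightarrow> X \<subseteq> verts J - C \<Longrightarrow> connected_in J X \<Longrightarrow>
    \<exists>Q\<subseteq>X. card Q \<le> Suc c \<and>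
      (\<forall>Y\<subseteq>X - Q. Y \<noteq> {} \<longrightarrow> connected_in J Y \<longrightarrow> (\<exists>x\<in>C. \<forall>y\<in>Y. \<not> adj J x y))"
proof (induction arbitrary: X C rule: chordal.induct)
  case empty
  then show ?case by (intro exI[of _ "{}"]) (auto simp: verts_def)
next
  case (add G v K)
  let ?J = "add_simplicial v K G"
  have gG: "is_graph G" using add.hyps(1) by (rule chordal_is_graph)
  note facts = gG add.hyps(2,3,4)
  note new = adj_add_simplicial_new[OF facts] and old = adj_add_simplicial_old[OF facts]
  have finK: "finite K" "finite C"
    using add.hyps(3) add.prems(1) finite_subset chordal_finite[OF add.hyps(1)] by auto
  have vK: "v \<notin> K" using add.hyps by blast
  show ?case
  proof (cases "v \<in> C")
    case True
    \<comment> \<open>Here \<open>v\<close> is the vertex of \<open>C\<close> to be cut off: its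
      neighbours in \<open>X\<close> are removed.\<close>
    have "card (K \<inter> X) \<le> Suc c" using card_mono[OF finK(1), of "K \<inter> X"] add.hyps(5) by simp
    moreover have "\<forall>y\<in>Y. \<not> adj ?J v y" if "Y \<subseteq> X - K \<inter> X" for Y
      using that new by blast
    ultimately show ?thesis using True by (intro exI[of _ "K \<inter> X"]) blast
  next
    case False
    then have CG: "C \<subseteq> verts G" using add.prems(1) by auto
    show ?thesis
    proof (cases "X = {v}")
      case True
      then show ?thesis by (intro exI[of _ "{v}"]) auto
    next
      case Xv: False
      have "X - {v} \<subseteq> verts G - C" using add.prems(3) by auto
      from add.IH[OF CG add.prems(2) this connected_in_add_simplicial_remove[OF facts add.prems(4)]]
      obtain Q where Q: "Q \<subseteq> X - {v}" "card Q \<le> Suc c"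
        and sep: "\<And>Y. Y \<subseteq> X - {v} - Q \<Longrightarrow> Y \<noteq> {} \<Longrightarrow> connected_in G Y \<Longrightarrow> \<exists>x\<in>C. \<forall>y\<in>Y. \<not> adj G x y"
        by blast
      have "\<exists>x\<in>C. \<forall>y\<in>Y. \<not> adj ?J x y"
        if Y: "Y \<subseteq> X - Q" "Y \<noteq> {}" "connected_in ?J Y" for Y
      proof (cases "Y = {v}")
        case True
        \<comment> \<open>\<open>K\<close> has at most \<open>c\<close> elements, so
          \<open>C\<close> inside \<open>K\<close> would mean \<open>C = K\<close>. But the
          connected set \<open>X\<close>, which here has more vertices than \<open>v\<close>, meets
          \<open>K\<close> and avoids \<open>C\<close>.\<close>
        have "\<not> C \<subseteq> K"
        proof
          assume "C \<subseteq> K"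
          then have "C = K" using card_seteq[OF finK(1)] add.hyps(5) add.prems(2) by simp
          moreover have "v \<in> X" using True Y by auto
          ultimately show False
            using connected_in_add_simplicial_meets[OF facts add.prems(4)] Xv add.prems(3) by blast
        qed
        then show ?thesis using True new adj_sym by blast
      next
        case Yv: False
        have "\<exists>x\<in>C. \<forall>y\<in>Y - {v}. \<not> adj G x y"
          by (rule sep) (use Y Yv connected_in_add_simplicial_remove[OF facts Y(3)] in auto)
        then obtain x where x: "x \<in> C" "\<forall>y\<in>Y - {v}. \<not> adj G x y" by blast
        \<comment> \<open>If \<open>x\<close> were adjacent to \<open>v\<close>, it would lie in
          \<open>K\<close>; then \<open>Y\<close> contains another element of \<open>K\<close>,
          adjacent to \<open>x\<close> since \<open>K\<close> is a clique.\<close>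
        have "\<not> adj ?J x v" if vY: "v \<in> Y"
        proof
          assume "adj ?J x v"
          then have "x \<in> K" using new adj_sym by blast
          obtain k where k: "k \<in> K" "k \<in> Y"
            using connected_in_add_simplicial_meets[OF facts Y(3) vY Yv] by blast
          moreover have "k \<noteq> x" using k x Y add.prems(3) by blast
          ultimately have "adj G x k"
            using add.hyps(4)[unfolded clique_def, rule_format, of x k] \<open>x \<in> K\<close> by simp
          then show False using x k vK by blast
        qed
        moreover have "\<not> adj ?J x y" if "y \<in> Y" "y \<noteq> v" for y
          using old[of x y] x that False by blast
        ultimately show ?thesis using x(1) by blast
      qed
      then show ?thesis using Q by (intro exI[of _ Q]) blast
    qed
  qed
qed

lemma components_connected:
  assumes "X \<in> components G W"
  shows "X \<subseteq> W" "X \<noteq> {}" "connected_in G X"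
  using assms unfolding components_def by blast+

text \<open>The map \<open>\<phi>\<close> from vertices to nodes sends connected sets to connected
  sets of \<open>J\<close>, so the separator that \<open>chordal_separate\<close> finds in
  \<open>J\<close> pulls back; each of its at most \<open>c + 1\<close> nodes stands for at most
  \<open>w\<close> vertices.\<close>

lemma H_partition_disjointed:
  assumes G: "is_graph G" and H: "is_graph H" "treewidth H \<le> c" and P: "H_partition G H P"
    and w: "\<And>x. x \<in> verts H \<Longrightarrow> card (P x) \<le> w"
  shows "disjointed G c (Suc c * w) (P ` verts H)"
proof -
  obtain J where J: "chordal c J" "verts J = verts H" "\<And>u v. adj H u v \<Longrightarrow> adj J u v"
    using treewidth_le_imp_chordal[OF H] by blast
  have Psub: "\<forall>x\<in>verts H. P x \<subseteq> verts G" and Pcov: "(\<Union>x\<in>verts H. P x) = verts G"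
    and Pdisj: "\<forall>x\<in>verts H. \<forall>y\<in>verts H. x \<noteq> y \<longrightarrow> P x \<inter> P y = {}"
    and Padj: "\<And>x y v w. x \<in> verts H \<Longrightarrow> y \<in> verts H \<Longrightarrow> v \<in> P x \<Longrightarrow> w \<in> P y \<Longrightarrow> adj G v w \<Longrightarrow> x = y \<or> adj H x y"
    using P unfolding H_partition_def by blast+
  have "\<forall>v\<in>verts G. \<exists>x\<in>verts H. v \<in> P x" using Pcov by blast
  then obtain \<phi> where \<phi>: "\<And>v. v \<in> verts G \<Longrightarrow> \<phi> v \<in> verts H \<and> v \<in> P (\<phi> v)" by metis
  have \<phi>_eq: "\<phi> v = x" if "x \<in> verts H" "v \<in> P x" for v x
    using that \<phi>[of v] Pdisj Psub by blast
  have image_con: "connected_in J (\<phi> ` Y)" if "Y \<subseteq> verts G" "connected_in G Y" for Y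
  proof (rule connected_inI)
    fix A assume A: "A \<subseteq> \<phi> ` Y" "A \<noteq> {}" and cl: "\<And>x y. x \<in> A \<Longrightarrow> y \<in> \<phi> ` Y \<Longrightarrow> adj J x y \<Longrightarrow> y \<in> A"
    have "Y \<subseteq> {y \<in> Y. \<phi> y \<in> A}"
    proof (rule connected_inD[OF that(2)])
      fix x y assume xy: "x \<in> {y \<in> Y. \<phi> y \<in> A}" "y \<in> Y" "adj G x y"
      then have "\<phi> x = \<phi> y \<or> adj H (\<phi> x) (\<phi> y)"
        using \<phi>[of x] \<phi>[of y] that(1) Padj[of "\<phi> x" "\<phi> y" x y] by blast
      then have "\<phi> y \<in> A" using xy J(3)[of "\<phi> x" "\<phi> y"] cl[of "\<phi> x" "\<phi> y"] by auto
      then show "y \<in> {y \<in> Y. \<phi> y \<in> A}" using xy by blast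
    qed (use A in auto)
    then show "\<phi> ` Y \<subseteq> A" by blast
  qed
  show ?thesis
    unfolding disjointed_def
  proof (intro allI impI ballI)
    fix Bs X
    assume Bs: "length Bs = c \<and> set Bs \<subseteq> P ` verts H" and X: "X \<in> components G (verts G - \<Union>(set Bs))"
    note X' = components_connected[OF X]
    have finX: "finite X" using X'(1) G finite_subset[of X "verts G"] unfolding is_graph_def by blast
    let ?goal = "\<exists>Q\<subseteq>X. card Q \<le> Suc c * w \<and> (\<forall>Y\<in>components G (X - Q). \<exists>i<c.
                  Y \<inter> nbhd G (Bs ! i - \<Union>(set (take i Bs))) = {})"
    show ?goal
    \<comment> \<open>An empty \<open>B_i'\<close> has no neighbours. Excluding this also excludes
      repeated entries of the tuple, so that exactly \<open>c\<close> nodes are deleted.\<close>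
    proof (cases "\<exists>i<c. Bs ! i - \<Union>(set (take i Bs)) = {}")
      case True
      then have "\<exists>i<c. Y \<inter> nbhd G (Bs ! i - \<Union>(set (take i Bs))) = {}" for Y
        by (auto simp: nbhd_def)
      then show ?thesis by (intro exI[of _ "{}"]) simp
    next
      case False
      have "\<forall>i<c. \<exists>x\<in>verts H. Bs ! i = P x" using Bs nth_mem by blast
      then obtain h where h: "\<And>i. i < c \<Longrightarrow> h i \<in> verts H \<and> Bs ! i = P (h i)" by metis
      have neq: "h i \<noteq> h j" if "i < j" "j < c" for i j
      proof
        assume "h i = h j"
        then have "Bs ! j = take j Bs ! i" using h that by simp
        then have "Bs ! j \<in> set (take j Bs)" using that Bs by (metis length_take min.absorb2 less_imp_le nth_mem)
        then show False using False that by blast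
      qed
      have "inj_on h {..<c}"
        by (rule linorder_inj_onI') (use neq in auto)
      then have cardC: "card (h ` {..<c}) = c" by (simp add: card_image)
      have "\<phi> ` X \<subseteq> verts J - h ` {..<c}"
      proof
        fix z assume "z \<in> \<phi> ` X"
        then obtain x where x: "x \<in> X" "z = \<phi> x" by blast
        have "z \<noteq> h i" if "i < c" for i
        proof -
          have "Bs ! i \<in> set Bs" using that Bs by simp
          then have "x \<notin> P (h i)" using x(1) X'(1) h[OF that] by auto
          then show ?thesis using x X'(1) \<phi>[of x] by auto
        qed
        then show "z \<in> verts J - h ` {..<c}" using x X'(1) \<phi>[of x] J(2) by blast
      qed
      moreover have "h ` {..<c} \<subseteq> verts J" using h J(2) by auto
      moreover have "connected_in J (\<phi> ` X)" using X' by (intro image_con) auto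
      ultimately have "\<exists>Q\<subseteq>\<phi> ` X. card Q \<le> Suc c \<and> (\<forall>Y\<subseteq>\<phi> ` X - Q. Y \<noteq> {} \<longrightarrow> connected_in J Y \<longrightarrow>
          (\<exists>x\<in>h ` {..<c}. \<forall>y\<in>Y. \<not> adj J x y))"
        using chordal_separate[OF J(1) _ cardC] by simp
      then obtain Q where Q: "Q \<subseteq> \<phi> ` X" "card Q \<le> Suc c"
        and sep: "\<And>Y. Y \<subseteq> \<phi> ` X - Q \<Longrightarrow> Y \<noteq> {} \<Longrightarrow> connected_in J Y \<Longrightarrow> \<exists>x\<in>h ` {..<c}. \<forall>y\<in>Y. \<not> adj J x y"
        by (elim exE conjE) (rule that, auto)
      define R where "R = {x \<in> X. \<phi> x \<in> Q}"
      have "R \<subseteq> (\<Union>q\<in>Q. P q)" using \<phi> X'(1) unfolding R_def by blast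
      moreover have finQ: "finite Q" using Q(1) finX finite_surj by blast
      moreover have QH: "Q \<subseteq> verts H" using Q(1) \<phi> X'(1) by blast
      moreover have "(\<Union>q\<in>Q. P q) \<subseteq> verts G" using QH Psub by blast
      then have "finite (\<Union>q\<in>Q. P q)"
        using G finite_subset[of _ "verts G"] unfolding is_graph_def by blast
      ultimately have "card R \<le> card (\<Union>q\<in>Q. P q)" by (intro card_mono)
      also have "\<dots> \<le> (\<Sum>q\<in>Q. card (P q))" by (rule card_UN_le[OF finQ])
      also have "\<dots> \<le> (\<Sum>q\<in>Q. w)" using QH w by (intro sum_mono) blast
      also have "\<dots> \<le> Suc c * w" using Q(2) by (simp del: mult_Suc)
      finally have "card R \<le> Suc c * w" .
      moreover have "\<exists>i<c. Y \<inter> nbhd G (Bs ! i - \<Union>(set (take i Bs))) = {}"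
        if Y: "Y \<in> components G (X - R)" for Y
      proof -
        note Y' = components_connected[OF Y]
        have YG: "Y \<subseteq> verts G" using Y' X' by blast
        have "\<phi> ` Y \<subseteq> \<phi> ` X - Q" using Y'(1) unfolding R_def by blast
        then obtain i where i: "i < c" "\<forall>y\<in>\<phi> ` Y. \<not> adj J (h i) y"
          using sep[of "\<phi> ` Y"] image_con[OF YG Y'(3)] Y'(2) by blast
        have "\<not> adj G y b" if yb: "y \<in> Y" "b \<in> Bs ! i" for y b
        proof
          assume "adj G y b"
          then have "\<phi> y = h i \<or> adj H (\<phi> y) (h i)"
            using Padj[of "\<phi> y" "h i" y b] \<phi>[of y] h[OF i(1)] yb YG by blast
          moreover have "\<phi> y \<noteq> h i"
          proof -
            have "Bs ! i \<in> set Bs" using i(1) Bs by simp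
            then have "y \<notin> P (h i)" using yb(1) Y'(1) X'(1) h[OF i(1)] by auto
            then show ?thesis using yb(1) YG \<phi>[of y] by auto
          qed
          ultimately show False using i(2) yb(1) J(3) adj_sym by blast
        qed
        then show ?thesis using i(1) unfolding nbhd_def by blast
      qed
      ultimately show ?goal by (intro exI[of _ R]) (auto simp: R_def)
    qed
  qed
qed

subsection \<open>From disjointed partitions to \<open>H\<close>-partitions\<close>

lemma mem_nbhd_iff: "v \<in> nbhd G Y \<longleftrightarrow> (\<exists>y\<in>Y. adj G v y)"
  by (simp add: nbhd_def)

text \<open>An index \<open>i\<close> stands for an already eliminated piece that is attached to the clique \<open>Ks i\<close> and to
  the chosen vertices \<open>Zs i\<close>. Eliminating \<open>v\<close> passes its piece on to the neighbours of \<open>v\<close>; when two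
  pieces meet in \<open>v\<close>, the clique \<open>insert v K\<close> is chosen, which merges them into one index and pays for
  the bound on \<open>card S\<close>.\<close>

lemma chordal_split_cliques:
  "chordal k J \<Longrightarrow> finite I \<Longrightarrow> (\<And>i. i \<in> I \<Longrightarrow> Ks i \<subseteq> verts J \<and> clique J (Ks i)) \<Longrightarrow>
    (\<And>i. i \<in> I \<Longrightarrow> finite (Zs i) \<and> card (Zs i) \<le> Suc k) \<Longrightarrow>
    \<exists>S\<subseteq>verts J. card S \<le> Suc k * card I \<and>
      (\<forall>Y\<subseteq>verts J - S. Y \<noteq> {} \<longrightarrow> connected_in J Y \<longrightarrow>
        (\<exists>Z. finite Z \<and> card Z \<le> 2 * Suc k \<and> nbhd J Y \<inter> S \<subseteq> Z \<and>
           (\<forall>i\<in>I. Ks i \<inter> Y \<noteq> {} \<longrightarrow> Zs i \<subseteq> Z)))"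
proof (induction arbitrary: I Ks Zs rule: chordal.induct)
  case empty
  then show ?case by (intro exI[of _ "{}"]) (auto simp: verts_def)
next
  case (add G v K)
  let ?J = "add_simplicial v K G"
  have gG: "is_graph G" using add.hyps(1) by (rule chordal_is_graph)
  note facts = gG add.hyps(2,3,4)
  note new = adj_add_simplicial_new[OF facts] and old = adj_add_simplicial_old[OF facts]
  have vK: "v \<notin> K" using add.hyps by blast
  have finK: "finite K" using add.hyps(3) finite_subset chordal_finite[OF add.hyps(1)] by auto
  have Ks_old: "Ks i \<subseteq> verts G \<and> clique G (Ks i)" if "i \<in> I" "v \<notin> Ks i" for i
  proof -
    have "adj G x y" if xy: "x \<in> Ks i" "y \<in> Ks i" "x \<noteq> y" for x y
    proof -
      have "x \<noteq> v" "y \<noteq> v" using xy \<open>v \<notin> Ks i\<close> by auto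
      then show ?thesis using add.prems(2)[OF \<open>i \<in> I\<close>] xy old unfolding clique_def by blast
    qed
    then show ?thesis using add.prems(2)[OF that(1)] that(2) by (auto simp: clique_def)
  qed
  have Ks_new: "Ks i \<subseteq> insert v K" if "i \<in> I" "v \<in> Ks i" for i
  proof
    fix x assume x: "x \<in> Ks i"
    have "clique ?J (Ks i)" using add.prems(2)[OF that(1)] by simp
    from this[unfolded clique_def, rule_format, of v x] show "x \<in> insert v K"
      using that(2) x new by blast
  qed
  \<comment> \<open>Deleting \<open>v\<close> from \<open>Y\<close> loses no attachment in
    \<open>S\<close>: a neighbour of \<open>v\<close> lies in the clique \<open>K\<close>, and
    \<open>Y\<close> contains another element of \<open>K\<close>.\<close>
  have nbhd_remove: "nbhd ?J Y \<inter> S \<subseteq> nbhd G (Y - {v}) \<inter> S"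
    if Y: "connected_in ?J Y" "Y \<noteq> {v}" "Y \<inter> S = {}" and S: "S \<subseteq> verts G" for Y S
  proof
    fix x assume x: "x \<in> nbhd ?J Y \<inter> S"
    then obtain y where y: "y \<in> Y" "adj ?J x y" by (auto simp: mem_nbhd_iff)
    have xv: "x \<noteq> v" using x S add.hyps(2) by blast
    show "x \<in> nbhd G (Y - {v}) \<inter> S"
    proof (cases "y = v")
      case True
      then have xK: "x \<in> K" using y new adj_sym by blast
      obtain u where u: "u \<in> K" "u \<in> Y"
        using connected_in_add_simplicial_meets[OF facts Y(1) _ Y(2)] True y by blast
      have "x \<noteq> u" using u x Y(3) by blast
      then have "adj G x u" using add.hyps(4)[unfolded clique_def, rule_format, of x u] xK u by simp
      then show ?thesis using u vK x by (auto simp: mem_nbhd_iff)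
    next
      case False
      then have "adj G x y" using y old xv by blast
      then show ?thesis using y x False by (auto simp: mem_nbhd_iff)
    qed
  qed
  have nbhd_v: "nbhd ?J {v} \<subseteq> K" using new adj_sym unfolding nbhd_def by blast
  show ?case
  proof (cases "\<exists>a\<in>I. \<exists>b\<in>I. a \<noteq> b \<and> v \<in> Ks a \<and> v \<in> Ks b")
    case True
    then obtain a b where ab: "a \<in> I" "b \<in> I" "a \<noteq> b" "v \<in> Ks a" "v \<in> Ks b" by blast
    \<comment> \<open>The index \<open>a\<close> takes over for all indices whose clique contains
      \<open>v\<close>, with clique \<open>K\<close> and chosen set \<open>insert v K\<close>. As
      \<open>b\<close> is dropped, one \<open>Suc k\<close> is saved for the vertices of
      \<open>insert v K\<close>.\<close>
    define I' where "I' = insert a {i \<in> I. v \<notin> Ks i}"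
    have I': "finite I'" "I' \<subseteq> I - {b}" using add.prems(1) ab unfolding I'_def by auto
    have "card I' < card I"
      using I' ab add.prems(1) by (intro psubset_card_mono) auto
    have "\<exists>S\<subseteq>verts G. card S \<le> Suc k * card I' \<and>
      (\<forall>Y\<subseteq>verts G - S. Y \<noteq> {} \<longrightarrow> connected_in G Y \<longrightarrow>
        (\<exists>Z. finite Z \<and> card Z \<le> 2 * Suc k \<and> nbhd G Y \<inter> S \<subseteq> Z \<and>
           (\<forall>i\<in>I'. (Ks(a := K)) i \<inter> Y \<noteq> {} \<longrightarrow> (Zs(a := insert v K)) i \<subseteq> Z)))"
    proof (rule add.IH[OF I'(1)])
      fix i assume i: "i \<in> I'"
      show "(Ks(a := K)) i \<subseteq> verts G \<and> clique G ((Ks(a := K)) i)"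
        using i Ks_old add.hyps(3,4) unfolding I'_def by auto
      show "finite ((Zs(a := insert v K)) i) \<and> card ((Zs(a := insert v K)) i) \<le> Suc k"
        using i add.prems(3)[of i] finK vK add.hyps(5) unfolding I'_def by auto
    qed
    then obtain S where S: "S \<subseteq> verts G" "card S \<le> Suc k * card I'"
      and "\<forall>Y\<subseteq>verts G - S. Y \<noteq> {} \<longrightarrow> connected_in G Y \<longrightarrow>
        (\<exists>Z. finite Z \<and> card Z \<le> 2 * Suc k \<and> nbhd G Y \<inter> S \<subseteq> Z \<and>
           (\<forall>i\<in>I'. (Ks(a := K)) i \<inter> Y \<noteq> {} \<longrightarrow> (Zs(a := insert v K)) i \<subseteq> Z))"
      by (elim exE conjE) (rule that)
    note split = this(3)[rule_format]
    let ?S = "S \<union> insert v K"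
    have "card ?S \<le> Suc k * card I' + Suc k"
      using S(2) card_Un_le[of S "insert v K"] finK vK add.hyps(5) by simp
    also have "\<dots> = Suc k * Suc (card I')" by simp
    also have "\<dots> \<le> Suc k * card I" using \<open>card I' < card I\<close> by (intro mult_le_mono2) simp
    finally have "card ?S \<le> Suc k * card I" .
    moreover have "?S \<subseteq> verts ?J" using S(1) add.hyps(3) by auto
    moreover have "\<exists>Z. finite Z \<and> card Z \<le> 2 * Suc k \<and> nbhd ?J Y \<inter> ?S \<subseteq> Z \<and>
           (\<forall>i\<in>I. Ks i \<inter> Y \<noteq> {} \<longrightarrow> Zs i \<subseteq> Z)"
      if Y: "Y \<subseteq> verts ?J - ?S" "Y \<noteq> {}" "connected_in ?J Y" for Y
    proof -
      have vY: "v \<notin> Y" "Y - {v} = Y" using Y by auto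
      have conY: "connected_in G Y" using connected_in_add_simplicial_remove[OF facts Y(3)] vY by simp
      have nb: "nbhd ?J Y \<inter> ?S \<subseteq> nbhd G Y \<inter> (S \<union> K)"
      proof
        fix x assume x: "x \<in> nbhd ?J Y \<inter> ?S"
        then obtain y where y: "y \<in> Y" "adj ?J x y" by (auto simp: mem_nbhd_iff)
        have "x \<noteq> v" using y new Y(1) by blast
        then show "x \<in> nbhd G Y \<inter> (S \<union> K)" using x y old[of x y] vY by (auto simp: mem_nbhd_iff)
      qed
      \<comment> \<open>If \<open>Y\<close> sees a vertex of \<open>K\<close> outside \<open>S\<close>, then absorbing those vertices makes the
        artificial clique \<open>K\<close> at index \<open>a\<close> account for all of \<open>insert v K\<close>.\<close>
      define N where "N = nbhd G Y \<inter> K - S"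
      have "connected_in G (Y \<union> N)"
      proof (rule connected_in_Un_neighbours[OF conY Y(2)])
        fix b assume "b \<in> N"
        then show "b \<in> Y \<or> (\<exists>a\<in>Y. adj G a b)" unfolding N_def nbhd_def using adj_sym by blast
      qed
      moreover have "Y \<union> N \<subseteq> verts G - S" using Y(1) vY add.hyps(3) unfolding N_def by auto
      moreover have "Y \<union> N \<noteq> {}" using Y(2) by blast
      ultimately obtain Z where Z: "finite Z" "card Z \<le> 2 * Suc k" "nbhd G (Y \<union> N) \<inter> S \<subseteq> Z"
        "\<And>i. i \<in> I' \<Longrightarrow> (Ks(a := K)) i \<inter> (Y \<union> N) \<noteq> {} \<Longrightarrow> (Zs(a := insert v K)) i \<subseteq> Z"
        using split by metis
      have "nbhd G Y \<inter> S \<subseteq> Z" using Z(3) unfolding nbhd_def by blast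
      moreover have "K \<subseteq> Z" if "N \<noteq> {}"
        using Z(4)[of a] that unfolding I'_def N_def by auto
      ultimately have "nbhd ?J Y \<inter> ?S \<subseteq> Z" using nb unfolding N_def by blast
      \<comment> \<open>A clique containing \<open>v\<close> lies in \<open>insert v K\<close>,
        which is part of \<open>?S\<close> and hence avoided by \<open>Y\<close>. So only indices
        whose clique avoids \<open>v\<close> impose a condition.\<close>
      moreover have "Zs i \<subseteq> Z" if i: "i \<in> I" "Ks i \<inter> Y \<noteq> {}" for i
      proof -
        have "v \<notin> Ks i" using Ks_new[OF i(1)] i(2) Y(1) by blast
        then have "i \<noteq> a" "i \<in> I'" using ab(4) i(1) unfolding I'_def by auto
        then show ?thesis using Z(4)[of i] i(2) by auto
      qed
      ultimately show ?thesis using Z(1,2) by blast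
    qed
    ultimately show ?thesis by (intro exI[of _ ?S]) blast
  next
    case one: False
    \<comment> \<open>At most one index has \<open>v\<close> in its clique; this index is passed on
      to \<open>K\<close>.\<close>
    define Ks' where "Ks' i = (if v \<in> Ks i then K else Ks i)" for i
    have "\<exists>S\<subseteq>verts G. card S \<le> Suc k * card I \<and>
      (\<forall>Y\<subseteq>verts G - S. Y \<noteq> {} \<longrightarrow> connected_in G Y \<longrightarrow>
        (\<exists>Z. finite Z \<and> card Z \<le> 2 * Suc k \<and> nbhd G Y \<inter> S \<subseteq> Z \<and>
           (\<forall>i\<in>I. Ks' i \<inter> Y \<noteq> {} \<longrightarrow> Zs i \<subseteq> Z)))"
      by (rule add.IH[OF add.prems(1)]) (use Ks_old add.hyps(3,4) add.prems(3) in \<open>auto simp: Ks'_def\<close>)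
    then obtain S where S: "S \<subseteq> verts G" "card S \<le> Suc k * card I"
      and "\<forall>Y\<subseteq>verts G - S. Y \<noteq> {} \<longrightarrow> connected_in G Y \<longrightarrow>
        (\<exists>Z. finite Z \<and> card Z \<le> 2 * Suc k \<and> nbhd G Y \<inter> S \<subseteq> Z \<and>
           (\<forall>i\<in>I. Ks' i \<inter> Y \<noteq> {} \<longrightarrow> Zs i \<subseteq> Z))"
      by (elim exE conjE) (rule that)
    note split = this(3)[rule_format]
    have "\<exists>Z. finite Z \<and> card Z \<le> 2 * Suc k \<and> nbhd ?J Y \<inter> S \<subseteq> Z \<and>
           (\<forall>i\<in>I. Ks i \<inter> Y \<noteq> {} \<longrightarrow> Zs i \<subseteq> Z)"
      if Y: "Y \<subseteq> verts ?J - S" "Y \<noteq> {}" "connected_in ?J Y" for Y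
    proof (cases "Y = {v}")
      case True
      \<comment> \<open>At most \<open>k\<close> vertices of \<open>K\<close> and at most one set
        \<open>Zs i\<close> of size at most \<open>Suc k\<close> fit into the bound.\<close>
      define Z where "Z = K \<union> (\<Union>i\<in>{i\<in>I. v \<in> Ks i}. Zs i)"
      obtain A where A: "(\<Union>i\<in>{i\<in>I. v \<in> Ks i}. Zs i) = A" "finite A" "card A \<le> Suc k"
      proof (cases "\<exists>i\<in>I. v \<in> Ks i")
        case True
        then obtain i where i: "i \<in> I" "v \<in> Ks i" by blast
        then have "{i\<in>I. v \<in> Ks i} = {i}" using one by blast
        then show ?thesis using that[of "Zs i"] add.prems(3)[OF i(1)] by simp
      next
        case False
        then have "(\<Union>i\<in>{i\<in>I. v \<in> Ks i}. Zs i) = {}" by blast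
        then show ?thesis by (rule that) simp_all
      qed
      have "finite Z" "card Z \<le> 2 * Suc k"
        using card_Un_le[of K A] finK A add.hyps(5) unfolding Z_def by auto
      moreover have "nbhd ?J Y \<inter> S \<subseteq> Z" using nbhd_v True unfolding Z_def by blast
      ultimately show ?thesis using True unfolding Z_def by (intro exI[of _ Z]) (auto simp: Z_def)
    next
      case False
      have "Y - {v} \<subseteq> verts G - S" "Y - {v} \<noteq> {}" using Y(1,2) False by auto
      then obtain Z where Z: "finite Z" "card Z \<le> 2 * Suc k" "nbhd G (Y - {v}) \<inter> S \<subseteq> Z"
        "\<And>i. i \<in> I \<Longrightarrow> Ks' i \<inter> (Y - {v}) \<noteq> {} \<Longrightarrow> Zs i \<subseteq> Z"
        using split connected_in_add_simplicial_remove[OF facts Y(3)] by metis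
      have "nbhd ?J Y \<inter> S \<subseteq> Z"
        using nbhd_remove[OF Y(3) False _ S(1)] Y(1) Z(3) by blast
      moreover have "Zs i \<subseteq> Z" if i: "i \<in> I" "Ks i \<inter> Y \<noteq> {}" for i
      proof (rule Z(4)[OF i(1)])
        show "Ks' i \<inter> (Y - {v}) \<noteq> {}"
        proof (cases "v \<in> Ks i \<and> v \<in> Y")
          case True
          \<comment> \<open>\<open>Y\<close> has further vertices, so being connected it meets
            \<open>K\<close>, the clique now carried by \<open>i\<close>.\<close>
          then obtain u where "u \<in> K" "u \<in> Y"
            using connected_in_add_simplicial_meets[OF facts Y(3) _ False] by blast
          then show ?thesis using True vK unfolding Ks'_def by auto
        next
          case vv: False
          then show ?thesis using i Ks_new[OF i(1)] unfolding Ks'_def by auto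
        qed
      qed
      ultimately show ?thesis using Z(1,2) by blast
    qed
    then show ?thesis using S by (intro exI[of _ S]) auto
  qed
qed

text \<open>Each \<open>r\<close> in \<open>R\<close> becomes its own index with clique
  \<open>{r}\<close> and chosen set \<open>{r}\<close>. The resulting set need not contain
  \<open>R\<close>, so \<open>R\<close> is added, which turns the factor \<open>k + 1\<close> into
  \<open>k + 2\<close>.\<close>

lemma chordal_split:
  assumes J: "chordal k J" and R: "R \<subseteq> verts J"
  obtains S where "R \<subseteq> S" "S \<subseteq> verts J" "card S \<le> (k + 2) * card R"
    "\<And>Y. Y \<subseteq> verts J - S \<Longrightarrow> Y \<noteq> {} \<Longrightarrow> connected_in J Y \<Longrightarrow> card (nbhd J Y \<inter> S) \<le> 2 * Suc k"
proof -
  have finR: "finite R" using R chordal_finite[OF J] finite_subset by blast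
  have "\<exists>S\<subseteq>verts J. card S \<le> Suc k * card R \<and>
      (\<forall>Y\<subseteq>verts J - S. Y \<noteq> {} \<longrightarrow> connected_in J Y \<longrightarrow>
        (\<exists>Z. finite Z \<and> card Z \<le> 2 * Suc k \<and> nbhd J Y \<inter> S \<subseteq> Z \<and>
           (\<forall>i\<in>R. {i} \<inter> Y \<noteq> {} \<longrightarrow> {i} \<subseteq> Z)))"
    by (rule chordal_split_cliques[OF J finR]) (use R in \<open>auto simp: clique_def\<close>)
  then obtain S where S: "S \<subseteq> verts J" "card S \<le> Suc k * card R"
    and "\<forall>Y\<subseteq>verts J - S. Y \<noteq> {} \<longrightarrow> connected_in J Y \<longrightarrow>
        (\<exists>Z. finite Z \<and> card Z \<le> 2 * Suc k \<and> nbhd J Y \<inter> S \<subseteq> Z \<and>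
           (\<forall>i\<in>R. {i} \<inter> Y \<noteq> {} \<longrightarrow> {i} \<subseteq> Z))"
    by (elim exE conjE) (rule that)
  note split = this(3)[rule_format]
  have "card (R \<union> S) \<le> (k + 2) * card R" using S(2) card_Un_le[of R S] by simp
  moreover have "card (nbhd J Y \<inter> (R \<union> S)) \<le> 2 * Suc k"
    if Y: "Y \<subseteq> verts J - (R \<union> S)" "Y \<noteq> {}" "connected_in J Y" for Y
  proof -
    \<comment> \<open>Vertices of \<open>R\<close> adjacent to \<open>Y\<close> but not in
      \<open>S\<close> are absorbed into the connected set, so that \<open>Z\<close> has to contain
      them.\<close>
    define N where "N = nbhd J Y \<inter> R - S"
    have "connected_in J (Y \<union> N)"
    proof (rule connected_in_Un_neighbours[OF Y(3,2)])
      fix b assume "b \<in> N"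
      then show "b \<in> Y \<or> (\<exists>a\<in>Y. adj J a b)" unfolding N_def nbhd_def using adj_sym by blast
    qed
    moreover have "Y \<union> N \<subseteq> verts J - S" "Y \<union> N \<noteq> {}" using Y R unfolding N_def by auto
    ultimately obtain Z where Z: "finite Z" "card Z \<le> 2 * Suc k" "nbhd J (Y \<union> N) \<inter> S \<subseteq> Z"
        "\<And>i. i \<in> R \<Longrightarrow> {i} \<inter> (Y \<union> N) \<noteq> {} \<Longrightarrow> {i} \<subseteq> Z"
      using split by metis
    have "nbhd J Y \<inter> S \<subseteq> Z" using Z(3) unfolding nbhd_def by blast
    moreover have "N \<subseteq> Z" using Z(4) unfolding N_def by blast
    ultimately have "nbhd J Y \<inter> (R \<union> S) \<subseteq> Z" unfolding N_def by blast
    then show ?thesis using card_mono[OF Z(1)] Z(2) by (meson le_trans)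
  qed
  ultimately show ?thesis using that[of "R \<union> S"] R S(1) by blast
qed

text \<open>A family \<open>\<S> l\<close> of at most \<open>m\<close> parts stands for their union; running through all choices of
  one part from each family costs a factor \<open>m ^ c\<close>.\<close>

lemma disjointed_families:
  assumes G: "is_graph G" and \<beta>: "l_partition G w \<beta>" and dis: "disjointed G c d \<beta>"
    and L: "finite L" "card L = c"
    and \<S>: "\<And>l. l \<in> L \<Longrightarrow> \<S> l \<subseteq> \<beta> \<and> finite (\<S> l) \<and> card (\<S> l) \<le> m \<and> \<Union>(\<S> l) \<inter> X = {}"
    and \<S>_disj: "\<And>l l'. l \<in> L \<Longrightarrow> l' \<in> L \<Longrightarrow> l \<noteq> l' \<Longrightarrow> \<S> l \<inter> \<S> l' = {}"
    and X: "X \<subseteq> verts G" "X \<noteq> {}" "connected_in G X"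
  obtains Q where "Q \<subseteq> X" "card Q \<le> m ^ c * d"
    "\<And>Y. Y \<subseteq> X - Q \<Longrightarrow> Y \<noteq> {} \<Longrightarrow> connected_in G Y \<Longrightarrow> \<exists>l\<in>L. Y \<inter> nbhd G (\<Union>(\<S> l)) = {}"
proof -
  have finG: "finite (verts G)" using G by (simp add: is_graph_def)
  obtain ls where ls: "set ls = L" "distinct ls" using finite_distinct_list[OF L(1)] by blast
  have len: "length ls = c" using ls L distinct_card by fastforce
  let ?F = "PiE L \<S>"
  have finF: "finite ?F" using L(1) \<S> by (intro finite_PiE) auto
  have "card ?F = (\<Prod>l\<in>L. card (\<S> l))" using L(1) by (rule card_PiE)
  also have "\<dots> \<le> m ^ c" using \<S> L(2) prod_le_power[of L "\<lambda>l. card (\<S> l)" m c] prod_mono[of L "\<lambda>l. card (\<S> l)" "\<lambda>_. m"] by simp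
  finally have cardF: "card ?F \<le> m ^ c" .
  have "\<exists>Q. finite Q \<and> card Q \<le> d \<and> (\<forall>Y. Y \<subseteq> X - Q \<longrightarrow> Y \<noteq> {} \<longrightarrow> connected_in G Y \<longrightarrow>
          (\<exists>l\<in>L. Y \<inter> nbhd G (h l) = {}))" if h: "h \<in> ?F" for h
  proof -
    let ?Bs = "map h ls"
    have hl: "h l \<in> \<S> l" if "l \<in> L" for l using h that by auto
    have "set ?Bs \<subseteq> \<beta>" using hl \<S> ls(1) by fastforce
    \<comment> \<open>\<open>X\<close> may be smaller than the component \<open>X'\<close>
      containing it; the separators are cut down to \<open>X\<close> only at the end.\<close>
    have "X \<subseteq> verts G - \<Union>(set ?Bs)" using X(1) hl \<S> ls(1) by fastforce
    then obtain X' where X': "X' \<in> components G (verts G - \<Union>(set ?Bs))" "X \<subseteq> X'"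
      using connected_in_component[of "verts G - \<Union>(set ?Bs)" X] finG X by blast
    then obtain Q where Q: "Q \<subseteq> X'" "card Q \<le> d"
      and sep: "\<And>Y. Y \<in> components G (X' - Q) \<Longrightarrow> \<exists>i<c. Y \<inter> nbhd G (?Bs ! i - \<Union>(set (take i ?Bs))) = {}"
      using dis \<open>set ?Bs \<subseteq> \<beta>\<close> len unfolding disjointed_def by (metis length_map)
    have finX': "finite X'" using components_connected(1)[OF X'(1)] finG finite_subset by blast
    have "\<exists>l\<in>L. Y \<inter> nbhd G (h l) = {}" if Y: "Y \<subseteq> X - Q" "Y \<noteq> {}" "connected_in G Y" for Y
    proof -
      have "Y \<subseteq> X' - Q" using Y(1) X'(2) by blast
      then obtain Y' where Y': "Y' \<in> components G (X' - Q)" "Y \<subseteq> Y'"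
        using connected_in_component[of "X' - Q" Y G] finX' Y by blast
      obtain i where i: "i < c" "Y' \<inter> nbhd G (?Bs ! i - \<Union>(set (take i ?Bs))) = {}" using sep[OF Y'(1)] by blast
      \<comment> \<open>Entries from disjoint families are different elements of
        \<open>\<beta>\<close>, hence disjoint sets, so \<open>B_i'\<close> is just
        \<open>B_i\<close>.\<close>
      have "?Bs ! i \<inter> B = {}" if B: "B \<in> set (take i ?Bs)" for B
      proof -
        obtain j where j: "j < i" "B = ?Bs ! j"
          using B i(1) len by (auto simp: in_set_conv_nth)
        have lij: "ls ! i \<in> L" "ls ! j \<in> L" "ls ! i \<noteq> ls ! j"
          using i(1) j(1) ls len nth_mem[of i ls] nth_mem[of j ls] nth_eq_iff_index_eq[of ls i j] by auto
        then have "h (ls ! i) \<noteq> h (ls ! j)" using hl[of "ls ! i"] hl[of "ls ! j"] \<S>_disj[of "ls ! i" "ls ! j"] by auto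
        moreover have "h (ls ! i) \<in> \<beta>" "h (ls ! j) \<in> \<beta>" using lij hl \<S> by blast+
        ultimately have "h (ls ! i) \<inter> h (ls ! j) = {}" using \<beta> unfolding l_partition_def by blast
        then show ?thesis using i(1) j len by simp
      qed
      then have "?Bs ! i - \<Union>(set (take i ?Bs)) = ?Bs ! i" by blast
      then have "Y \<inter> nbhd G (h (ls ! i)) = {}" using i Y'(2) len by auto
      then show ?thesis using i(1) ls(1) len nth_mem by blast
    qed
    moreover have "finite Q" using Q(1) finX' finite_subset by blast
    ultimately show ?thesis using Q(2) by blast
  qed
  then obtain Q where Q: "\<And>h. h \<in> ?F \<Longrightarrow> finite (Q h) \<and> card (Q h) \<le> d"
    and sep: "\<And>h Y. h \<in> ?F \<Longrightarrow> Y \<subseteq> X - Q h \<Longrightarrow> Y \<noteq> {} \<Longrightarrow> connected_in G Y \<Longrightarrow> \<exists>l\<in>L. Y \<inter> nbhd G (h l) = {}"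
    by metis
  define R where "R = X \<inter> (\<Union>h\<in>?F. Q h)"
  have "card R \<le> card (\<Union>h\<in>?F. Q h)" unfolding R_def using finF Q by (intro card_mono) auto
  also have "\<dots> \<le> (\<Sum>h\<in>?F. card (Q h))" by (rule card_UN_le[OF finF])
  also have "\<dots> \<le> (\<Sum>h\<in>?F. d)" using Q by (intro sum_mono) blast
  also have "\<dots> \<le> m ^ c * d" using cardF by simp
  finally have "card R \<le> m ^ c * d" .
  moreover have "\<exists>l\<in>L. Y \<inter> nbhd G (\<Union>(\<S> l)) = {}" if Y: "Y \<subseteq> X - R" "Y \<noteq> {}" "connected_in G Y" for Y
  proof (rule ccontr)
    assume none: "\<not> ?thesis"
    \<comment> \<open>Otherwise \<open>Y\<close> is adjacent to some element of every family, which
      contradicts the separator for that choice of elements.\<close>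
    have "\<exists>B\<in>\<S> l. Y \<inter> nbhd G B \<noteq> {}" if "l \<in> L" for l
    proof -
      have "Y \<inter> nbhd G (\<Union>(\<S> l)) \<noteq> {}"
      proof
        assume "Y \<inter> nbhd G (\<Union>(\<S> l)) = {}"
        then have "\<exists>l\<in>L. Y \<inter> nbhd G (\<Union>(\<S> l)) = {}" using that by (rule bexI)
        with none show False by (rule notE)
      qed
      then obtain y where y: "y \<in> Y" "y \<in> nbhd G (\<Union>(\<S> l))" by auto
      then obtain b B where "B \<in> \<S> l" "b \<in> B" "adj G y b" by (auto simp: mem_nbhd_iff)
      then have "y \<in> nbhd G B" by (auto simp: mem_nbhd_iff)
      then show ?thesis using y(1) \<open>B \<in> \<S> l\<close> by blast
    qed
    then obtain h where h: "\<And>l. l \<in> L \<Longrightarrow> h l \<in> \<S> l \<and> Y \<inter> nbhd G (h l) \<noteq> {}" by metis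
    let ?h = "restrict h L"
    have hF: "?h \<in> ?F" using h by auto
    then have "Y \<subseteq> X - Q ?h" using Y(1) unfolding R_def by blast
    from sep[OF hF this Y(2,3)] show False using h by auto
  qed
  moreover have "R \<subseteq> X" unfolding R_def by blast
  ultimately show ?thesis using that by blast
qed

text \<open>Part of an \<open>H\<close>-partition covering only \<open>W\<close>: the part of \<open>x\<close> is \<open>{v \<in> W. \<phi> v = x}\<close>, with \<open>H\<close>
  completed to a chordal graph. A connected set outside \<open>W\<close> may be adjacent to at most \<open>c\<close> parts,
  and to each of them only inside the union of few elements of \<open>\<beta>\<close>.\<close>

definition context_bound ::
  "ugraph \<Rightarrow> nat set set \<Rightarrow> nat \<Rightarrow> nat \<Rightarrow> nat set \<Rightarrow> ugraph \<Rightarrow> (nat \<Rightarrow> nat) \<Rightarrow> nat set \<Rightarrow>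
   nat set \<Rightarrow> (nat \<Rightarrow> nat set set) \<Rightarrow> bool" where
  "context_bound G \<beta> c m W H \<phi> X L \<S> \<longleftrightarrow>
     L \<subseteq> verts H \<and> clique H L \<and> card L \<le> c \<and>
     (\<forall>l\<in>L. \<S> l \<subseteq> \<beta> \<and> finite (\<S> l) \<and> card (\<S> l) \<le> m \<and> \<Union>(\<S> l) \<inter> X = {}) \<and>
     (\<forall>l\<in>L. \<forall>l'\<in>L. l \<noteq> l' \<longrightarrow> \<S> l \<inter> \<S> l' = {}) \<and>
     (\<forall>w\<in>W. \<forall>x\<in>X. adj G x w \<longrightarrow> \<phi> w \<in> L \<and> w \<in> \<Union>(\<S> (\<phi> w)))"

text \<open>Nodes of \<open>H\<close> are taken from \<open>W\<close>, so any vertex of a new part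
  can name its new node. The last condition concerns all connected \<open>X\<close>, since a
  connected set in a smaller rest is again one in the larger.\<close>

definition partial_partition ::
  "ugraph \<Rightarrow> nat set set \<Rightarrow> nat \<Rightarrow> nat \<Rightarrow> nat \<Rightarrow> nat set \<Rightarrow> ugraph \<Rightarrow> (nat \<Rightarrow> nat) \<Rightarrow> bool" where
  "partial_partition G \<beta> c m w W H \<phi> \<longleftrightarrow>
     W \<subseteq> verts G \<and> chordal c H \<and> verts H \<subseteq> W \<and> \<phi> ` W \<subseteq> verts H \<and>
     (\<forall>x. card {v \<in> W. \<phi> v = x} \<le> w) \<and>
     (\<forall>u\<in>W. \<forall>v\<in>W. adj G u v \<longrightarrow> \<phi> u = \<phi> v \<or> adj H (\<phi> u) (\<phi> v)) \<and>
     (\<forall>X\<subseteq>verts G - W. X \<noteq> {} \<longrightarrow> connected_in G X \<longrightarrow> (\<exists>L \<S>. context_bound G \<beta> c m W H \<phi> X L \<S>))"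

section \<open>Building the \<open>H\<close>-partition part by part\<close>

locale disjointed_partition =
  fixes G :: ugraph and \<beta> :: "nat set set" and c d w k :: nat
  assumes G: "is_graph G" and tw: "treewidth G \<le> k"
    and \<beta>: "l_partition G w \<beta>" and dis: "disjointed G c d \<beta>"
begin

text \<open>The number of attachments that \<open>chordal_split\<close> allows; each of them
  contributes at most one element of \<open>\<beta>\<close> to the family of a new part.\<close>

definition m :: nat where "m = 2 * Suc k"

text \<open>\<open>Suc (m ^ c * d)\<close> bounds the nonempty separator,
  \<open>chordal_split\<close> enlarges it by the factor \<open>k + 2\<close>, and every vertex of
  the result brings in at most the \<open>w\<close> vertices of its element of
  \<open>\<beta>\<close>.\<close>

definition width :: nat where "width = (k + 2) * Suc (m ^ c * d) * w"

lemma finite_verts: "finite (verts G)"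
  using G by (simp add: is_graph_def)

lemma blocks:
  obtains blk where "\<And>v. v \<in> verts G \<Longrightarrow> blk v \<in> \<beta> \<and> v \<in> blk v"
    "\<And>v. v \<in> verts G \<Longrightarrow> finite (blk v) \<and> card (blk v) \<le> w"
proof -
  have "\<forall>v\<in>verts G. \<exists>B\<in>\<beta>. v \<in> B" using \<beta> unfolding l_partition_def by blast
  then obtain blk where blk: "\<And>v. v \<in> verts G \<Longrightarrow> blk v \<in> \<beta> \<and> v \<in> blk v" by metis
  moreover have "finite (blk v) \<and> card (blk v) \<le> w" if "v \<in> verts G" for v
    using blk[OF that] \<beta> finite_verts finite_subset[of "blk v" "verts G"] unfolding l_partition_def by blast
  ultimately show ?thesis using that by blast
qed

text \<open>With exactly \<open>c\<close> attached parts, \<open>disjointed_families\<close> yields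
  a separator after which each remaining piece misses one part. With fewer, nothing has to be lost
  and a single vertex suffices.\<close>

lemma obtain_separator:
  assumes ctx: "context_bound G \<beta> c m W H \<phi> X L \<S>" and H: "finite (verts H)"
    and X: "X \<subseteq> verts G" "X \<noteq> {}" "connected_in G X"
  obtains Q where "Q \<subseteq> X" "Q \<noteq> {}" "card Q \<le> Suc (m ^ c * d)"
    "\<And>Z. Z \<subseteq> X - Q \<Longrightarrow> Z \<noteq> {} \<Longrightarrow> connected_in G Z \<Longrightarrow>
      \<exists>L'\<subseteq>L. card L' < c \<and> (\<forall>w\<in>W. \<forall>z\<in>Z. adj G z w \<longrightarrow> \<phi> w \<in> L')"
proof -
  obtain x where x: "x \<in> X" using X by blast
  have finL: "finite L" using ctx H finite_subset unfolding context_bound_def by blast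
  have ctx': "card L \<le> c"
    "\<And>l. l \<in> L \<Longrightarrow> \<S> l \<subseteq> \<beta> \<and> finite (\<S> l) \<and> card (\<S> l) \<le> m \<and> \<Union>(\<S> l) \<inter> X = {}"
    "\<And>l l'. l \<in> L \<Longrightarrow> l' \<in> L \<Longrightarrow> l \<noteq> l' \<Longrightarrow> \<S> l \<inter> \<S> l' = {}"
    "\<And>w x. w \<in> W \<Longrightarrow> x \<in> X \<Longrightarrow> adj G x w \<Longrightarrow> \<phi> w \<in> L \<and> w \<in> \<Union>(\<S> (\<phi> w))"
    using ctx unfolding context_bound_def by blast+
  show ?thesis
  proof (cases "card L = c")
    case True
    obtain Q where Q: "Q \<subseteq> X" "card Q \<le> m ^ c * d"
      and sep: "\<And>Y. Y \<subseteq> X - Q \<Longrightarrow> Y \<noteq> {} \<Longrightarrow> connected_in G Y \<Longrightarrow> \<exists>l\<in>L. Y \<inter> nbhd G (\<Union>(\<S> l)) = {}"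
      by (rule disjointed_families[where \<S> = \<S> and L = L, OF G \<beta> dis finL True ctx'(2,3) X], assumption+) (rule that)
    have finQ: "finite Q" using Q(1) X(1) finite_verts finite_subset by (meson subset_trans)
    show ?thesis
    \<comment> \<open>The additional vertex \<open>x\<close> makes the new part nonempty.\<close>
    proof (rule that[of "insert x Q"])
      show "card (insert x Q) \<le> Suc (m ^ c * d)" using Q(2) finQ by (simp add: card_insert_if)
      fix Z assume Z: "Z \<subseteq> X - insert x Q" "Z \<noteq> {}" "connected_in G Z"
      then have "Z \<subseteq> X - Q" by blast
      from sep[OF this Z(2,3)] obtain l where l: "l \<in> L" "Z \<inter> nbhd G (\<Union>(\<S> l)) = {}" by blast
      have "card (L - {l}) < c" using True l(1) finL by (metis card_Diff1_less)
      \<comment> \<open>Edges from \<open>X\<close> into the part of \<open>l\<close> end in the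
        family \<open>\<S> l\<close>, which \<open>Z\<close> does not see.\<close>
      moreover have "\<phi> w \<in> L - {l}" if "w \<in> W" "z \<in> Z" "adj G z w" for w z
      proof -
        have "\<phi> w \<in> L \<and> w \<in> \<Union>(\<S> (\<phi> w))" using ctx'(4) that Z(1) by blast
        moreover have "w \<notin> \<Union>(\<S> l)" using l(2) that unfolding nbhd_def by blast
        ultimately show ?thesis by auto
      qed
      ultimately show "\<exists>L'\<subseteq>L. card L' < c \<and> (\<forall>w\<in>W. \<forall>z\<in>Z. adj G z w \<longrightarrow> \<phi> w \<in> L')"
        by (intro exI[of _ "L - {l}"]) auto
    qed (use Q x in auto)
  next
    case False
    then have "card L < c" using ctx'(1) by simp
    then have "\<exists>L'\<subseteq>L. card L' < c \<and> (\<forall>w\<in>W. \<forall>z\<in>Z. adj G z w \<longrightarrow> \<phi> w \<in> L')" if "Z \<subseteq> X - {x}" for Z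
      using ctx'(4) that by (intro exI[of _ L]) blast
    then show ?thesis using that[of "{x}"] x by auto
  qed
qed

text \<open>Besides a set \<open>S\<close> cutting \<open>G\<close> into pieces with few attachments, the new part takes from each
  piece \<open>C\<close> only those vertices that share an element of \<open>\<beta>\<close> with an attachment of \<open>C\<close>. Closing \<open>S\<close>
  completely under \<open>\<beta>\<close> would let a piece see too many elements of \<open>\<beta>\<close>.\<close>

lemma obtain_part:
  assumes Q: "Q \<subseteq> X" and X: "X \<subseteq> verts G"
  obtains P where "Q \<subseteq> P" "P \<subseteq> X" "card P \<le> (k + 2) * card Q * w"
    "\<And>Z. Z \<subseteq> X - P \<Longrightarrow> Z \<noteq> {} \<Longrightarrow> connected_in G Z \<Longrightarrow>
      \<exists>\<T>\<subseteq>\<beta>. finite \<T> \<and> card \<T> \<le> m \<and> \<Union>\<T> \<inter> Z = {} \<and> nbhd G Z \<inter> P \<subseteq> \<Union>\<T> \<and> (\<forall>B\<in>\<T>. B \<inter> X \<noteq> {})"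
proof -
  obtain J where J: "chordal k J" "verts J = verts G" "\<And>u v. adj G u v \<Longrightarrow> adj J u v"
    using treewidth_le_imp_chordal[OF G tw] by blast
  obtain blk where blk: "\<And>v. v \<in> verts G \<Longrightarrow> blk v \<in> \<beta> \<and> v \<in> blk v"
    and blk_fin: "\<And>v. v \<in> verts G \<Longrightarrow> finite (blk v) \<and> card (blk v) \<le> w"
    using blocks by blast
  obtain S' where S': "Q \<subseteq> S'" "S' \<subseteq> verts G" "card S' \<le> (k + 2) * card Q"
    and split: "\<And>Y. Y \<subseteq> verts G - S' \<Longrightarrow> Y \<noteq> {} \<Longrightarrow> connected_in J Y \<Longrightarrow> card (nbhd J Y \<inter> S') \<le> m"
    using chordal_split[OF J(1), of Q] Q X unfolding J(2) m_def by blast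
  define S where "S = S' \<inter> X"
  have S: "Q \<subseteq> S" "S \<subseteq> X" "S \<subseteq> verts G" using S' Q X unfolding S_def by auto
  have finS: "finite S" using S(3) finite_verts finite_subset by blast
  have few: "card (nbhd G Y \<inter> S) \<le> m" if Y: "Y \<subseteq> X - S" "Y \<noteq> {}" "connected_in G Y" for Y
  proof -
    have "Y \<subseteq> verts G - S'" using Y(1) X unfolding S_def by blast
    moreover have "connected_in J Y" using connected_in_mono[OF Y(3)] J(3) by blast
    ultimately have "card (nbhd J Y \<inter> S') \<le> m" using split Y(2) by blast
    moreover have "nbhd G Y \<inter> S \<subseteq> nbhd J Y \<inter> S'" using J(3) unfolding nbhd_def S_def by blast
    moreover have "finite (nbhd J Y \<inter> S')" using S'(2) finite_verts finite_subset by blast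
    ultimately show ?thesis using card_mono le_trans by blast
  qed
  define P where "P = S \<union> {v \<in> X - S. \<exists>C r. C \<subseteq> X - S \<and> connected_in G C \<and> v \<in> C \<and>
                          r \<in> nbhd G C \<inter> S \<and> v \<in> blk r}"
  have "P \<subseteq> (\<Union>r\<in>S. blk r)" using blk S(3) unfolding P_def by blast
  moreover have "finite (\<Union>r\<in>S. blk r)" using finS S(3) blk_fin by blast
  ultimately have "card P \<le> card (\<Union>r\<in>S. blk r)" by (intro card_mono)
  also have "\<dots> \<le> (\<Sum>r\<in>S. card (blk r))" by (rule card_UN_le[OF finS])
  also have "\<dots> \<le> (\<Sum>r\<in>S. w)" using S(3) blk_fin by (intro sum_mono) blast
  also have "\<dots> \<le> card S' * w"
    using card_mono[of S' S] S'(2) finite_verts finite_subset[of S'] unfolding S_def by simp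
  also have "\<dots> \<le> (k + 2) * card Q * w" using S'(3) by (intro mult_le_mono1)
  finally have cardP: "card P \<le> (k + 2) * card Q * w" .
  have attach: "\<exists>\<T>\<subseteq>\<beta>. finite \<T> \<and> card \<T> \<le> m \<and> \<Union>\<T> \<inter> Z = {} \<and> nbhd G Z \<inter> P \<subseteq> \<Union>\<T> \<and> (\<forall>B\<in>\<T>. B \<inter> X \<noteq> {})"
    if Z: "Z \<subseteq> X - P" "Z \<noteq> {}" "connected_in G Z" for Z
  proof -
    have ZS: "Z \<subseteq> X - S" using Z(1) unfolding P_def by blast
    have "finite (X - S)" using X finite_verts finite_subset by blast
    then obtain C where C: "C \<in> components G (X - S)" "Z \<subseteq> C"
      using connected_in_component[of "X - S" Z G] ZS Z by blast
    note C' = components_connected[OF C(1)]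
    let ?N = "nbhd G C \<inter> S" and ?T = "blk ` (nbhd G C \<inter> S)"
    have "?T \<subseteq> \<beta>" using blk S(3) by blast
    moreover have "finite ?T" using finS by simp
    moreover have "card ?T \<le> m"
      using few[OF C'] card_image_le[of ?N blk] finS by (meson finite_Int le_trans)
    moreover have "\<Union>?T \<inter> Z = {}"
    proof -
      \<comment> \<open>If an element of \<open>\<beta>\<close> contains an attachment of
        \<open>C\<close>, all its vertices in \<open>C\<close> are moved into
        \<open>P\<close>.\<close>
      have "v \<in> P" if "r \<in> ?N" "v \<in> blk r" "v \<in> Z" for r v
        using that C' C(2) ZS unfolding P_def by blast
      then show ?thesis using Z(1) by blast
    qed
    moreover have "v \<in> \<Union>?T" if v: "v \<in> nbhd G Z \<inter> P" for v
    proof (cases "v \<in> S")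
      case True
      then have "v \<in> ?N" using v C(2) unfolding nbhd_def by blast
      then show ?thesis using blk S(3) by blast
    next
      case False
      \<comment> \<open>\<open>v\<close> entered \<open>P\<close> because of some connected
        \<open>D\<close>. As \<open>v\<close> is adjacent to \<open>Z\<close>, \<open>D\<close> lies
        in \<open>C\<close>, and the attachment \<open>r\<close> of \<open>D\<close> is one of
        \<open>C\<close>.\<close>
      then obtain D r where D: "D \<subseteq> X - S" "connected_in G D" "v \<in> D" "r \<in> nbhd G D \<inter> S" "v \<in> blk r"
        using v unfolding P_def by blast
      obtain z where z: "z \<in> Z" "adj G z v" using v adj_sym unfolding nbhd_def by blast
      have "v \<in> C" by (rule component_absorbs_neighbour[OF C(1) _ _ z(2)]) (use z C D in auto)
      then have "D \<subseteq> C" using component_absorbs[OF C(1) D(1,2)] D(3) by blast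
      then have "r \<in> ?N" using D(4) unfolding nbhd_def by blast
      then show ?thesis using D(5) by blast
    qed
    \<comment> \<open>Attachments lie in \<open>X\<close>; this keeps \<open>\<T>\<close> apart from
      the earlier families, which avoid \<open>X\<close>.\<close>
    moreover have "\<forall>B\<in>?T. B \<inter> X \<noteq> {}" using blk S(2,3) by blast
    ultimately show ?thesis by (intro exI[of _ ?T]) blast
  qed
  have "Q \<subseteq> P" "P \<subseteq> X" using S unfolding P_def by auto
  then show ?thesis by (rule that[OF _ _ cardP attach])
qed

text \<open>A component \<open>X\<close> of the rest receives the new part \<open>P\<close>, whose
  node \<open>p\<close> is joined to the clique \<open>L\<close>. Connected sets outside
  \<open>X\<close> do not see \<open>P\<close>; those inside keep fewer than \<open>c\<close> of the
  old parts and gain \<open>p\<close>.\<close>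

lemma partial_partition_step:
  assumes part: "partial_partition G \<beta> c m width W H \<phi>" and W: "W \<noteq> verts G"
  obtains W' H' \<phi>' where "W \<subset> W'" "partial_partition G \<beta> c m width W' H' \<phi>'"
proof -
  note part' = part[unfolded partial_partition_def]
  have WG: "W \<subseteq> verts G" and H: "chordal c H" and HW: "verts H \<subseteq> W" and \<phi>: "\<phi> ` W \<subseteq> verts H"
    and width: "\<And>x. card {v \<in> W. \<phi> v = x} \<le> width"
    and edge: "\<And>u v. u \<in> W \<Longrightarrow> v \<in> W \<Longrightarrow> adj G u v \<Longrightarrow> \<phi> u = \<phi> v \<or> adj H (\<phi> u) (\<phi> v)"
    using part' by simp_all
  have ctx: "\<exists>L \<S>. context_bound G \<beta> c m W H \<phi> X L \<S>"
    if "X \<subseteq> verts G - W" "X \<noteq> {}" "connected_in G X" for X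
    using part' that by simp
  obtain x where x: "x \<in> verts G - W" using W WG by blast
  obtain X where X: "X \<in> components G (verts G - W)"
    using connected_in_component[of "verts G - W" "{x}" G] x finite_verts by auto
  note X' = components_connected[OF X]
  have XG: "X \<subseteq> verts G" "X \<inter> W = {}" using X'(1) by auto
  obtain L \<S> where LS: "context_bound G \<beta> c m W H \<phi> X L \<S>" using ctx[OF X'] by blast
  have L: "L \<subseteq> verts H" "clique H L" "card L \<le> c"
    and \<S>: "\<And>l. l \<in> L \<Longrightarrow> \<S> l \<subseteq> \<beta> \<and> finite (\<S> l) \<and> card (\<S> l) \<le> m \<and> \<Union>(\<S> l) \<inter> X = {}"
    and \<S>_disj: "\<And>l l'. l \<in> L \<Longrightarrow> l' \<in> L \<Longrightarrow> l \<noteq> l' \<Longrightarrow> \<S> l \<inter> \<S> l' = {}"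
    and nbX: "\<And>w x. w \<in> W \<Longrightarrow> x \<in> X \<Longrightarrow> adj G x w \<Longrightarrow> \<phi> w \<in> L \<and> w \<in> \<Union>(\<S> (\<phi> w))"
    using LS unfolding context_bound_def by blast+
  obtain Q where Q: "Q \<subseteq> X" "Q \<noteq> {}" "card Q \<le> Suc (m ^ c * d)"
    and sep: "\<And>Z. Z \<subseteq> X - Q \<Longrightarrow> Z \<noteq> {} \<Longrightarrow> connected_in G Z \<Longrightarrow>
      \<exists>L'\<subseteq>L. card L' < c \<and> (\<forall>w\<in>W. \<forall>z\<in>Z. adj G z w \<longrightarrow> \<phi> w \<in> L')"
    using obtain_separator[OF LS chordal_finite[OF H] XG(1) X'(2,3)] by blast
  obtain P where P: "Q \<subseteq> P" "P \<subseteq> X" "card P \<le> (k + 2) * card Q * w"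
    and attach: "\<And>Z. Z \<subseteq> X - P \<Longrightarrow> Z \<noteq> {} \<Longrightarrow> connected_in G Z \<Longrightarrow>
      \<exists>\<T>\<subseteq>\<beta>. finite \<T> \<and> card \<T> \<le> m \<and> \<Union>\<T> \<inter> Z = {} \<and> nbhd G Z \<inter> P \<subseteq> \<Union>\<T> \<and> (\<forall>B\<in>\<T>. B \<inter> X \<noteq> {})"
    using obtain_part[OF Q(1) XG(1)] by blast
  have cardP: "card P \<le> width"
    using P(3) Q(3) unfolding width_def by (meson le_trans mult_le_mono1 mult_le_mono2)
  \<comment> \<open>A vertex of the new part names its node; it is fresh because
    \<open>verts H\<close> lies in \<open>W\<close>.\<close>
  obtain p where p: "p \<in> P" using P(1) Q(2) by blast
  have pW: "p \<notin> W" using p P(2) XG by blast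
  then have pH: "p \<notin> verts H" and pL: "p \<notin> L" using HW L(1) by auto
  define H' where "H' = add_simplicial p L H"
  define \<phi>' where "\<phi>' v = (if v \<in> P then p else \<phi> v)" for v
  have PW: "P \<inter> W = {}" using P(2) XG by blast
  then have \<phi>'W: "\<phi>' v = \<phi> v" if "v \<in> W" for v using that unfolding \<phi>'_def by auto
  have \<phi>'P: "\<phi>' v = p" if "v \<in> P" for v using that unfolding \<phi>'_def by auto
  have adjH': "adj H' x y \<longleftrightarrow> adj H x y \<or> x = p \<and> y \<in> L \<or> y = p \<and> x \<in> L" for x y
    unfolding H'_def by (rule adj_add_simplicial[OF pL])
  have vH': "verts H' = insert p (verts H)" unfolding H'_def by simp
  have cl_mono: "clique H' K" if "clique H K" for K using that unfolding clique_def adjH' by blast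
  have finL: "finite L" using L(1) chordal_finite[OF H] finite_subset by blast
  have PX_edge: "adj H' (\<phi> u) p" if "u \<in> W" "v \<in> P" "adj G v u" for u v
    using nbX[OF that(1), of v] that P(2) unfolding adjH' by blast
  have "partial_partition G \<beta> c m width (W \<union> P) H' \<phi>'"
    unfolding partial_partition_def
  proof (intro conjI allI ballI impI)
    show "W \<union> P \<subseteq> verts G" using WG P(2) XG by blast
    show "chordal c H'" unfolding H'_def by (rule chordal.add[OF H pH L])
    show "verts H' \<subseteq> W \<union> P" using vH' HW p by auto
    show "\<phi>' ` (W \<union> P) \<subseteq> verts H'" using \<phi> \<phi>'W \<phi>'P vH' by auto
    show "card {v \<in> W \<union> P. \<phi>' v = x} \<le> width" for x
    proof (cases "x = p")
      case True
      then have "{v \<in> W \<union> P. \<phi>' v = x} = P" using \<phi>'P \<phi>'W \<phi> pH by auto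
      then show ?thesis using cardP by simp
    next
      case False
      then have "{v \<in> W \<union> P. \<phi>' v = x} = {v \<in> W. \<phi> v = x}" using \<phi>'P \<phi>'W by auto
      then show ?thesis using width by simp
    qed
    show "\<phi>' u = \<phi>' v \<or> adj H' (\<phi>' u) (\<phi>' v)" if uv: "u \<in> W \<union> P" "v \<in> W \<union> P" "adj G u v" for u v
    proof (cases "u \<in> P"; cases "v \<in> P")
      assume "u \<in> P" "v \<in> P"
      then show ?thesis using \<phi>'P by simp
    next
      assume a: "u \<in> P" "v \<notin> P"
      then have "v \<in> W" using uv by blast
      then show ?thesis using PX_edge[OF _ a(1) uv(3)] \<phi>'P[OF a(1)] \<phi>'W adj_sym by metis
    next
      assume a: "u \<notin> P" "v \<in> P"
      then have "u \<in> W" using uv by blast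
      then show ?thesis using PX_edge[OF _ a(2)] \<phi>'P[OF a(2)] \<phi>'W uv(3) adj_sym by metis
    next
      assume "u \<notin> P" "v \<notin> P"
      then have "u \<in> W" "v \<in> W" using uv by auto
      then show ?thesis using edge[OF _ _ uv(3)] \<phi>'W adjH' by auto
    qed
    fix Z assume Z: "Z \<subseteq> verts G - (W \<union> P)" "Z \<noteq> {}" "connected_in G Z"
    have ZW: "Z \<subseteq> verts G - W" using Z(1) by blast
    show "\<exists>L \<S>. context_bound G \<beta> c m (W \<union> P) H' \<phi>' Z L \<S>"
    proof (cases "Z \<inter> X = {}")
      case True
      obtain M \<U> where M: "context_bound G \<beta> c m W H \<phi> Z M \<U>" using ctx[OF ZW Z(2,3)] by blast
      \<comment> \<open>A neighbour of the component \<open>X\<close> in the rest would belong to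
        \<open>X\<close>, so \<open>Z\<close> does not see \<open>P\<close>.\<close>
      have "\<not> adj G z v" if "z \<in> Z" "v \<in> P" for z v
        using component_absorbs_neighbour[OF X, of v z] that P(2) ZW True adj_sym by blast
      moreover have "\<phi>' v \<in> M \<and> v \<in> \<Union>(\<U> (\<phi>' v))" if "v \<in> W" "z \<in> Z" "adj G z v" for v z
        using M that \<phi>'W[OF that(1)] unfolding context_bound_def by metis
      ultimately have "\<forall>v\<in>W \<union> P. \<forall>z\<in>Z. adj G z v \<longrightarrow> \<phi>' v \<in> M \<and> v \<in> \<Union>(\<U> (\<phi>' v))"
        by blast
      then have "context_bound G \<beta> c m (W \<union> P) H' \<phi>' Z M \<U>"
        using M cl_mono vH' unfolding context_bound_def by auto
      then show ?thesis by blast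
    next
      case False
      then have ZX: "Z \<subseteq> X - P" using component_absorbs[OF X ZW Z(3)] Z(1) by blast
      then have "Z \<subseteq> X - Q" using P(1) by blast
      then obtain L' where L': "L' \<subseteq> L" "card L' < c" "\<And>w z. w \<in> W \<Longrightarrow> z \<in> Z \<Longrightarrow> adj G z w \<Longrightarrow> \<phi> w \<in> L'"
        using sep[OF \<open>Z \<subseteq> X - Q\<close> Z(2,3)] by (elim exE conjE) (rule that, auto)
      obtain \<T> where T: "\<T> \<subseteq> \<beta>" "finite \<T>" "card \<T> \<le> m" "\<Union>\<T> \<inter> Z = {}" "nbhd G Z \<inter> P \<subseteq> \<Union>\<T>"
        "\<And>B. B \<in> \<T> \<Longrightarrow> B \<inter> X \<noteq> {}"
        using attach[OF ZX Z(2,3)] by (elim exE conjE) (rule that, auto)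
      have pL': "p \<notin> L'" using pL L'(1) by blast
      let ?\<S> = "\<S>(p := \<T>)"
      have TS: "\<T> \<inter> \<S> l = {}" if "l \<in> L'" for l
        using T(6) \<S>[of l] that L'(1) by blast
      have "context_bound G \<beta> c m (W \<union> P) H' \<phi>' Z (insert p L') ?\<S>"
        unfolding context_bound_def
      proof (intro conjI ballI impI)
        show "insert p L' \<subseteq> verts H'" using L(1) L'(1) vH' by auto
        show "clique H' (insert p L')"
          using cl_mono[OF clique_subset[OF L(2) L'(1)]] L'(1) unfolding clique_insert adjH' by blast
        show "card (insert p L') \<le> c" using L'(2) pL' finite_subset[OF L'(1) finL] by simp
        fix l assume l: "l \<in> insert p L'"
        have lL: "l = p \<or> l \<noteq> p \<and> l \<in> L" using l L'(1) by blast
        show "?\<S> l \<subseteq> \<beta>" "finite (?\<S> l)" "card (?\<S> l) \<le> m" using lL \<S>[of l] T(1-3) by auto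
        show "\<Union>(?\<S> l) \<inter> Z = {}"
        proof (cases "l = p")
          case False
          then show ?thesis using lL \<S>[of l] ZX by auto
        qed (use T(4) in simp)
        fix l' assume l': "l' \<in> insert p L'" "l \<noteq> l'"
        show "?\<S> l \<inter> ?\<S> l' = {}"
          using l l' TS[of l] TS[of l'] \<S>_disj[of l l'] L'(1) by (auto simp: Int_commute)
      next
        fix v z assume vz: "v \<in> W \<union> P" "z \<in> Z" "adj G z v"
        show "\<phi>' v \<in> insert p L'"
          using vz \<phi>'P \<phi>'W L'(3) by auto
        show "v \<in> \<Union>(?\<S> (\<phi>' v))"
        proof (cases "v \<in> P")
          case True
          then have "v \<in> nbhd G Z \<inter> P" using vz adj_sym unfolding nbhd_def by blast
          then show ?thesis using T(5) \<phi>'P[OF True] by auto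
        next
          case False
          then have vW: "v \<in> W" using vz by blast
          have "\<phi> v \<noteq> p" using \<phi> vW pH by blast
          then show ?thesis using nbX[OF vW _ vz(3)] vz(2) ZX \<phi>'W[OF vW] by auto
        qed
      qed
      then show ?thesis by blast
    qed
  qed
  then show ?thesis using that p pW by blast
qed

lemma tpw_le: "tpw c G \<le> width"
proof -
  \<comment> \<open>Nothing is covered yet: with \<open>W\<close> empty, \<open>L = {}\<close>
    satisfies the invariant.\<close>
  have "partial_partition G \<beta> c m width {} ({}, {}) (\<lambda>_. 0)"
    by (auto simp: partial_partition_def context_bound_def chordal.empty verts_def clique_def)
  moreover have "\<exists>H \<phi>. partial_partition G \<beta> c m width (verts G) H \<phi>"
    if "partial_partition G \<beta> c m width W H \<phi>" for W H \<phi>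
    using that
  proof (induction "card (verts G - W)" arbitrary: W H \<phi> rule: less_induct)
    case less
    show ?case
    proof (cases "W = verts G")
      case False
      obtain W' H' \<phi>' where step: "W \<subset> W'" "partial_partition G \<beta> c m width W' H' \<phi>'"
        using partial_partition_step[OF less.prems False] by blast
      moreover have "W' \<subseteq> verts G" using step(2) by (simp add: partial_partition_def)
      ultimately have "verts G - W' \<subset> verts G - W" by blast
      then show ?thesis using less.hyps[OF _ step(2)] finite_verts by (simp add: psubset_card_mono)
    qed (use less.prems in blast)
  qed
  ultimately obtain H \<phi> where "partial_partition G \<beta> c m width (verts G) H \<phi>" by blast
  then have H: "chordal c H" "\<phi> ` verts G \<subseteq> verts H" "\<And>x. card {v \<in> verts G. \<phi> v = x} \<le> width"
    and edge: "\<And>u v. u \<in> verts G \<Longrightarrow> v \<in> verts G \<Longrightarrow> adj G u v \<Longrightarrow> \<phi> u = \<phi> v \<or> adj H (\<phi> u) (\<phi> v)"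
    unfolding partial_partition_def by blast+
  let ?P = "\<lambda>x. {v \<in> verts G. \<phi> v = x}"
  have "H_partition G H ?P" using H(2) edge unfolding H_partition_def by auto
  moreover have "is_graph H" "treewidth H \<le> c"
    using chordal_is_graph[OF H(1)] treewidth_le_if_chordal[OF H(1)] by auto
  ultimately have "tpw c G \<le> partition_width H ?P"
    unfolding tpw_def by (intro Least_le) blast
  also have "\<dots> \<le> width"
    using H(3) chordal_finite[OF H(1)] unfolding partition_width_def by (intro Max.boundedI) auto
  finally show ?thesis .
qed

end

section \<open>The equivalence for graph classes\<close>

lemma tpw_attained:
  assumes "is_graph G"
  obtains H P where "is_graph H" "treewidth H \<le> c" "H_partition G H P" "partition_width H P = tpw c G"
proof -
  \<comment> \<open>A single node holding all of \<open>verts G\<close> shows that the minimum is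
    over a nonempty set; the one-vertex graph has treewidth 0.\<close>
  let ?H = "({0}, {}) :: ugraph"
  have "is_graph ?H" using singleton_is_tree by (simp add: is_tree_def)
  moreover have "tree_decomposition ?H ?H (\<lambda>_. {0})"
    using single_bag_tree_decomposition[OF \<open>is_graph ?H\<close>, of 0] by (simp add: verts_def)
  then have "treewidth ?H \<le> td_width ?H (\<lambda>_. {0})"
    unfolding treewidth_def by (intro Least_le) blast
  then have "treewidth ?H \<le> c" by (simp add: td_width_def verts_def)
  moreover have "H_partition G ?H (\<lambda>_. verts G)" by (auto simp: H_partition_def verts_def)
  ultimately have "\<exists>k H P. is_graph H \<and> treewidth H \<le> c \<and> H_partition G H P \<and> partition_width H P = k"
    by blast
  then have "\<exists>H P. is_graph H \<and> treewidth H \<le> c \<and> H_partition G H P \<and> partition_width H P = tpw c G"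
    unfolding tpw_def by (rule LeastI_ex)
  then show ?thesis using that by blast
qed

text \<open>For fixed \<open>c\<close>, the bounds of both directions depend on the graph only
  through its treewidth, so a bounding function on one side gives one on the other.\<close>

lemma tpw_bounded_iff_disjointed_width_property:
  assumes "\<And>G. G \<in> \<G> \<Longrightarrow> is_graph G"
  shows "(\<exists>f::nat \<Rightarrow> nat. \<forall>G\<in>\<G>. tpw c G \<le> f (treewidth G)) \<longleftrightarrow> disjointed_width_property \<G> c"
proof
  assume "\<exists>f::nat \<Rightarrow> nat. \<forall>G\<in>\<G>. tpw c G \<le> f (treewidth G)"
  then obtain f :: "nat \<Rightarrow> nat" where f: "\<And>G. G \<in> \<G> \<Longrightarrow> tpw c G \<le> f (treewidth G)" by blast
  \<comment> \<open>Large enough for both the parts and the separators; the inner \<open>Suc\<close>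
    keeps it at least 1 where \<open>f\<close> vanishes.\<close>
  define g where "g n = Suc c * Suc (f n)" for n
  have "\<exists>\<beta>. l_partition G (g (treewidth G)) \<beta> \<and> disjointed G c (g (treewidth G)) \<beta>" if GG: "G \<in> \<G>" for G
  proof -
    obtain H P where H: "is_graph H" "treewidth H \<le> c" "H_partition G H P" "partition_width H P = tpw c G"
      using tpw_attained[OF assms[OF GG]] by blast
    have w: "card (P x) \<le> Suc (f (treewidth G))" if "x \<in> verts H" for x
    proof -
      have "card (P x) \<le> partition_width H P"
        using that H(1) unfolding partition_width_def is_graph_def by (intro Max_ge) auto
      then show ?thesis using H(4) f[OF GG] by simp
    qed
    have le: "Suc (f (treewidth G)) \<le> g (treewidth G)" unfolding g_def by simp
    have "l_partition G (g (treewidth G)) (P ` verts H)"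
      unfolding l_partition_def
    proof (intro conjI ballI impI)
      fix B assume "B \<in> P ` verts H"
      then obtain x where x: "x \<in> verts H" "B = P x" by blast
      then show "B \<subseteq> verts G" using H(3) by (simp add: H_partition_def)
      show "card B \<le> g (treewidth G)" using w[OF x(1)] le x(2) by simp
    next
      fix B1 B2 assume B: "B1 \<in> P ` verts H" "B2 \<in> P ` verts H" "B1 \<noteq> B2"
      then obtain x y where "x \<in> verts H" "y \<in> verts H" "B1 = P x" "B2 = P y" by blast
      then show "B1 \<inter> B2 = {}" using H(3) B(3) unfolding H_partition_def by metis
    qed (use H(3) in \<open>simp add: H_partition_def\<close>)
    moreover have "disjointed G c (g (treewidth G)) (P ` verts H)"
      unfolding g_def by (rule H_partition_disjointed[OF assms[OF GG] H(1-3) w])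
    ultimately show ?thesis by blast
  qed
  moreover have "g n \<ge> 1" for n unfolding g_def by simp
  ultimately show "disjointed_width_property \<G> c" unfolding disjointed_width_property_def by blast
next
  assume "disjointed_width_property \<G> c"
  then obtain g where g: "\<And>G. G \<in> \<G> \<Longrightarrow> \<exists>\<beta>. l_partition G (g (treewidth G)) \<beta> \<and> disjointed G c (g (treewidth G)) \<beta>"
    unfolding disjointed_width_property_def by blast
  have "tpw c G \<le> disjointed_partition.width c (g (treewidth G)) (g (treewidth G)) (treewidth G)"
    if GG: "G \<in> \<G>" for G
  proof -
    obtain \<beta> where "l_partition G (g (treewidth G)) \<beta>" "disjointed G c (g (treewidth G)) \<beta>"
      using g[OF GG] by blast
    then interpret disjointed_partition G \<beta> c "g (treewidth G)" "g (treewidth G)" "treewidth G"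
      using assms[OF GG] by unfold_locales auto
    show ?thesis by (rule tpw_le)
  qed
  then show "\<exists>f::nat \<Rightarrow> nat. \<forall>G\<in>\<G>. tpw c G \<le> f (treewidth G)"
    by (intro exI[of _ "\<lambda>n. disjointed_partition.width c (g n) (g n) n"]) blast
qed

theorem theorem3p9:
  assumes "graph_class \<G>"
  shows "underlying_treewidth \<G> = disjointed_treewidth \<G>"
proof -
  have "is_graph G" if "G \<in> \<G>" for G using assms that by (simp add: graph_class_def)
  then show ?thesis
    unfolding underlying_treewidth_def disjointed_treewidth_def
    by (simp add: tpw_bounded_iff_disjointed_width_property)
qed

end
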